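(* Let $0<\varepsilon\ll 1$, let $c,f$ be smooth functions on $[0,1]$ with $c(x)\ge \tilde\gamma^2>0$ on $[0,1]$, and let $u$ be the solution of $$-\varepsilon^2u''+c\,u=f \text{ in } (0,1),\qquad u(0)=u(1)=0 .$$ Fix a polynomial degree $k\ge1$ and $H\in(0,1)$. Let $u^N\in V^N$ be the NIPG solution, i.e. $a(u^N,v^N)=l(v^N)$ for all $v^N\in V^N$, on the Duran–Lombardi mesh described in the context, with penalty parameters $\sigma_i=\varepsilon$ if $x_i\in\{x_0,x_N\}$ and $\sigma_i=\varepsilon H^{-1}$ if $x_i\in(0,1)$. Then $$\|u-u^N\|_{dG}\le CH^{k+1}+C(\varepsilon\ln(1/\varepsilon))^{1/2}H^k,$$ where $C$ is a positive constant independent of $\varepsilon$, $H$ and $N$.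
   Context: Duran–Lombardi mesh: with $\ell=[1/H]$, $$x_i=\begin{cases} iH\varepsilon, & 0\le i<\ell+1,\\ (1+H)x_{i-1}, & \ell+1\le i\le M-1,\\ 1/2, & i=M,\end{cases}$$ where $M$ is such that $x_{M-1}<1/2$ and $(1+H)x_{M-1}\ge 1/2$; on $[1/2,1]$ the mesh is reflected, $x_{M+i}=1-x_{M-i}$, $i=1,\dots,M$, so there are $N=2M$ subintervals (if the interval $(x_{M-1},1/2)$ is too small compared with $(x_{M-2},x_{M-1})$, the points $x_{M-1},x_{M+1}$ are omitted). $I_i=(x_{i-1},x_i)$. Spaces: $V=\{v\in L^2(0,1): v|_{I_i}\in H^1(I_i)\ \forall i\}$, $V^N=\{v\in L^2(0,1): v|_{I_i}\in\mathbb P_k(I_i)\ \forall i\}$. For $v\in V$: $[v]_i=v(x_i+0)-v(x_i-0)$, $\langle v\rangle_i=\tfrac12(v(x_i+0)+v(x_i-0))$ at interior nodes; $[v]_0=\langle v\rangle_0=v(x_0+0)$; $[v]_N=-\langle v\rangle_N=-v(x_N-0)$. NIPG method: for $w,v\in V$, $$a(w,v)=\sum_{i=1}^N\int_{I_i}(\varepsilon^2w'v'+cwv)\,dx+\sum_{i=0}^N\big(\varepsilon^2\langle w'\rangle_i[v]_i-\varepsilon^2[w]_i\langle v'\rangle_i+\sigma_i[w]_i[v]_i\big),\qquad l(v)=\sum_{i=1}^N\int_{I_i}fv\,dx.$$ Energy norm: $\|w\|_{dG}^2=a(w,w)$. *)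

theory Defs
  imports "HOL-Analysis.Analysis" "HOL-Computational_Algebra.Polynomial"
begin

definition smooth_on_01 :: "(real \<Rightarrow> real) \<Rightarrow> bool" where
  "smooth_on_01 g \<longleftrightarrow>
     (\<exists>D :: nat \<Rightarrow> real \<Rightarrow> real. (\<forall>x\<in>{0..1}. D 0 x = g x) \<and>
        (\<forall>n. \<forall>x\<in>{0..1}. (D n has_real_derivative D (Suc n) x) (at x within {0..1})))"

definition dl_ell :: "real \<Rightarrow> nat" where
  "dl_ell H = nat \<lfloor>1 / H\<rfloor>"

definition dl_base :: "real \<Rightarrow> real \<Rightarrow> nat \<Rightarrow> real" where
  "dl_base \<epsilon> H i =
     (if i \<le> dl_ell H then real i * H * \<epsilon>
      else (1 + H) ^ (i - dl_ell H) * (real (dl_ell H) * H * \<epsilon>))"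

definition dl_M :: "real \<Rightarrow> real \<Rightarrow> nat" where
  "dl_M \<epsilon> H = (LEAST m. 1 / 2 \<le> dl_base \<epsilon> H m)"

text \<open>Number of subintervals on [0,1/2]; if omit, the points x_{M-1}, x_{M+1} are dropped.\<close>
definition dl_half :: "real \<Rightarrow> real \<Rightarrow> bool \<Rightarrow> nat" where
  "dl_half \<epsilon> H omit = (if omit then dl_M \<epsilon> H - 1 else dl_M \<epsilon> H)"

definition dl_N :: "real \<Rightarrow> real \<Rightarrow> bool \<Rightarrow> nat" where
  "dl_N \<epsilon> H omit = 2 * dl_half \<epsilon> H omit"

definition dl_node :: "real \<Rightarrow> real \<Rightarrow> bool \<Rightarrow> nat \<Rightarrow> real" where
  "dl_node \<epsilon> H omit i =
     (let Mh = dl_half \<epsilon> H omit in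
      if i < Mh then dl_base \<epsilon> H i
      else if i = Mh then 1 / 2
      else 1 - dl_base \<epsilon> H (2 * Mh - i))"

text \<open>A broken function w in V is represented by its pieces: w i is the restriction
  to I_i = (x (i-1), x i), i = 1..N, taken with its traces at the endpoints;
  w' i is the derivative of the piece w i on the closed element.\<close>

definition jump :: "nat \<Rightarrow> (nat \<Rightarrow> real) \<Rightarrow> (nat \<Rightarrow> real \<Rightarrow> real) \<Rightarrow> nat \<Rightarrow> real" where
  "jump N x w i =
     (if i = 0 then w 1 (x 0)
      else if i = N then - w N (x N)
      else w (Suc i) (x i) - w i (x i))"

definition avg :: "nat \<Rightarrow> (nat \<Rightarrow> real) \<Rightarrow> (nat \<Rightarrow> real \<Rightarrow> real) \<Rightarrow> nat \<Rightarrow> real" where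
  "avg N x w i =
     (if i = 0 then w 1 (x 0)
      else if i = N then w N (x N)
      else (w (Suc i) (x i) + w i (x i)) / 2)"

definition nipg_form ::
  "real \<Rightarrow> (real \<Rightarrow> real) \<Rightarrow> (nat \<Rightarrow> real) \<Rightarrow> nat \<Rightarrow> (nat \<Rightarrow> real)
   \<Rightarrow> (nat \<Rightarrow> real \<Rightarrow> real) \<Rightarrow> (nat \<Rightarrow> real \<Rightarrow> real)
   \<Rightarrow> (nat \<Rightarrow> real \<Rightarrow> real) \<Rightarrow> (nat \<Rightarrow> real \<Rightarrow> real) \<Rightarrow> real" where
  "nipg_form \<epsilon> c \<sigma> N x w w' v v' =
     (\<Sum>i=1..N. integral {x (i - 1)..x i} (\<lambda>t. \<epsilon>^2 * w' i t * v' i t + c t * w i t * v i t))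
     + (\<Sum>i=0..N. \<epsilon>^2 * avg N x w' i * jump N x v i
                  - \<epsilon>^2 * jump N x w i * avg N x v' i
                  + \<sigma> i * jump N x w i * jump N x v i)"

definition nipg_rhs ::
  "(real \<Rightarrow> real) \<Rightarrow> nat \<Rightarrow> (nat \<Rightarrow> real) \<Rightarrow> (nat \<Rightarrow> real \<Rightarrow> real) \<Rightarrow> real" where
  "nipg_rhs f N x v = (\<Sum>i=1..N. integral {x (i - 1)..x i} (\<lambda>t. f t * v i t))"

definition nipg_sigma :: "real \<Rightarrow> real \<Rightarrow> nat \<Rightarrow> nat \<Rightarrow> real" where
  "nipg_sigma \<epsilon> H N i = (if i = 0 \<or> i = N then \<epsilon> else \<epsilon> / H)"

definition dg_norm ::
  "real \<Rightarrow> (real \<Rightarrow> real) \<Rightarrow> (nat \<Rightarrow> real) \<Rightarrow> nat \<Rightarrow> (nat \<Rightarrow> real)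
   \<Rightarrow> (nat \<Rightarrow> real \<Rightarrow> real) \<Rightarrow> (nat \<Rightarrow> real \<Rightarrow> real) \<Rightarrow> real" where
  "dg_norm \<epsilon> c \<sigma> N x w w' = sqrt (nipg_form \<epsilon> c \<sigma> N x w w' w w')"

definition nipg_solution ::
  "real \<Rightarrow> real \<Rightarrow> bool \<Rightarrow> (real \<Rightarrow> real) \<Rightarrow> (real \<Rightarrow> real) \<Rightarrow> nat \<Rightarrow> (nat \<Rightarrow> real poly) \<Rightarrow> bool" where
  "nipg_solution \<epsilon> H omit c f k P \<longleftrightarrow>
     (let N = dl_N \<epsilon> H omit; x = dl_node \<epsilon> H omit; \<sigma> = nipg_sigma \<epsilon> H N in
      (\<forall>i\<in>{1..N}. degree (P i) \<le> k) \<and>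
      (\<forall>Q :: nat \<Rightarrow> real poly. (\<forall>i\<in>{1..N}. degree (Q i) \<le> k) \<longrightarrow>
          nipg_form \<epsilon> c \<sigma> N x (\<lambda>i. poly (P i)) (\<lambda>i. poly (pderiv (P i)))
                              (\<lambda>i. poly (Q i)) (\<lambda>i. poly (pderiv (Q i)))
          = nipg_rhs f N x (\<lambda>i. poly (Q i))))"

definition nipg_error ::
  "real \<Rightarrow> real \<Rightarrow> bool \<Rightarrow> (real \<Rightarrow> real) \<Rightarrow> (real \<Rightarrow> real) \<Rightarrow> (real \<Rightarrow> real) \<Rightarrow> (nat \<Rightarrow> real poly) \<Rightarrow> real" where
  "nipg_error \<epsilon> H omit c u u1 P =
     (let N = dl_N \<epsilon> H omit in
      dg_norm \<epsilon> c (nipg_sigma \<epsilon> H N) N (dl_node \<epsilon> H omit)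
        (\<lambda>i t. u t - poly (P i) t) (\<lambda>i t. u1 t - poly (pderiv (P i)) t))"

end

theory Submission
  imports Defs
begin

text \<open>
  The interpolant is, on every element, the Taylor polynomial at the left node plus a linear correction
  that makes it exact at the right node. The interpolation error \<open>\<eta>\<close> then has no jumps, so that in
  \<open>a(\<xi>, \<xi>) = a(\<eta>, \<xi>)\<close>, where \<open>\<xi>\<close> is the difference of the discrete solution and the interpolant,
  only the flux averages of \<open>\<eta>\<close> meet the jumps of \<open>\<xi>\<close>, and Young's inequality suffices: no inverse
  inequality is needed.

  The derivatives of \<open>u\<close> satisfy \<open>\<bar>u\<^sup>(\<^sup>j\<^sup>)\<bar> \<le> C (1 + \<epsilon>\<^sup>-\<^sup>j B)\<close> with \<open>B\<close> the sum of the two boundary layers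
  \<open>exp (- \<gamma> x / (2 \<epsilon>))\<close> and \<open>exp (- \<gamma> (1 - x) / (2 \<epsilon>))\<close>. This follows by induction on \<open>j\<close> from the maximum
  principle for the differentiated equation; halving the exponent makes \<open>B\<close> a strict supersolution,
  which absorbs the commutator terms. An element at distance \<open>d\<close> from the boundary has length at most
  \<open>3 H (d + \<epsilon>)\<close>, and the layer turns the powers of \<open>(d + \<epsilon>) / \<epsilon>\<close> into constants. Each element thus
  contributes \<open>O(\<epsilon> H\<^sup>2\<^sup>k\<^sup>+\<^sup>1)\<close> to the squared derivative and flux parts, and the number of elements is
  \<open>O(H\<^sup>-\<^sup>1 ln (1 / \<epsilon>))\<close>, whence the logarithm.
\<close>

section \<open>Maximum principle and layer barriers\<close>

text \<open>At a negative interior minimum the first derivative vanishes and the differential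
  inequality forces a negative second derivative. Hence \<open>z1\<close> is negative just to the
  right of the minimum, and the mean value theorem produces a still smaller value.\<close>

lemma min_principle:
  fixes z z1 z2 c :: "real \<Rightarrow> real" and \<epsilon> :: real
  assumes d1: "\<And>x. x \<in> {0..1} \<Longrightarrow> (z has_real_derivative z1 x) (at x within {0..1})"
    and d2: "\<And>x. x \<in> {0..1} \<Longrightarrow> (z1 has_real_derivative z2 x) (at x within {0..1})"
    and L: "\<And>x. x \<in> {0<..<1} \<Longrightarrow> 0 \<le> - (\<epsilon>\<^sup>2 * z2 x) + c x * z x"
    and c: "\<And>x. x \<in> {0<..<1} \<Longrightarrow> 0 < c x"
    and \<epsilon>: "0 < \<epsilon>" and "0 \<le> z 0" "0 \<le> z 1" and x: "x \<in> {0..1}"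
  shows "0 \<le> z x"
proof (rule ccontr)
  assume neg: "\<not> 0 \<le> z x"
  have "continuous_on {0..1} z"
    using d1 DERIV_continuous_on by blast
  then obtain m where m: "m \<in> {0..1}" and mmin: "\<And>y. y \<in> {0..1} \<Longrightarrow> z m \<le> z y"
    using continuous_attains_inf[of "{0..1::real}" z] by auto
  have zm: "z m < 0" using mmin[OF x] neg by linarith
  with m assms(6,7) have m01: "0 < m" "m < 1"
    by (metis atLeastAtMost_iff less_eq_real_def not_less)+
  have at1: "(z has_real_derivative z1 y) (at y)" "(z1 has_real_derivative z2 y) (at y)" 
    if "0 < y" "y < 1" for y
    using d1[of y] d2[of y] that at_within_Icc_at[of 0 y 1] by auto
  have "z1 m = 0"
  proof (rule DERIV_local_min[OF at1(1)[OF m01]])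
    show "0 < min m (1 - m)" using m01 by simp
    show "\<forall>y. \<bar>m - y\<bar> < min m (1 - m) \<longrightarrow> z m \<le> z y"
      using mmin by (auto simp: abs_if split: if_splits)
  qed
  moreover have "z2 m < 0"
  proof -
    have "c m * z m < 0" using c[of m] zm m01 by (simp add: mult_pos_neg)
    then have "\<epsilon>\<^sup>2 * z2 m < 0" using L[of m] m01 by auto
    then show ?thesis using \<epsilon> by (simp add: mult_less_0_iff)
  qed
  ultimately obtain d where d: "d > 0" "\<And>h. 0 < h \<Longrightarrow> h < d \<Longrightarrow> z1 (m + h) < 0"
    using DERIV_neg_dec_right[OF at1(2)[OF m01]] by auto
  define h where "h = min d (1 - m) / 2"
  have h: "0 < h" "h < d" "m + h < 1" using d m01 by (auto simp: h_def min_def field_simps)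
  obtain \<xi> where xi: "m < \<xi>" "\<xi> < m + h" "z (m + h) - z m = (m + h - m) * z1 \<xi>"
    using MVT2[of m "m + h" z z1] at1(1) h m01 by (smt (verit))
  have "z1 \<xi> < 0" using d(2)[of "\<xi> - m"] xi h by auto
  then have "z (m + h) < z m" using xi h mult_pos_neg[of h "z1 \<xi>"]
    by simp
  moreover have "z m \<le> z (m + h)" using mmin h m01 by auto
  ultimately show False by simp
qed

definition layer :: "real \<Rightarrow> real \<Rightarrow> real \<Rightarrow> real" where
  "layer \<gamma> \<epsilon> x = exp (- (\<gamma> / (2 * \<epsilon>) * x)) + exp (- (\<gamma> / (2 * \<epsilon>) * (1 - x)))"

lemma layer_nonneg: "0 \<le> layer \<gamma> \<epsilon> x"
  by (simp add: layer_def)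

lemma layer_le_2: "\<gamma> > 0 \<Longrightarrow> \<epsilon> > 0 \<Longrightarrow> x \<in> {0..1} \<Longrightarrow> layer \<gamma> \<epsilon> x \<le> 2"
  unfolding layer_def by (rule order_trans[OF add_mono[of _ 1 _ 1]]) auto

lemma layer_endpoint: "a \<in> {0, 1} \<Longrightarrow> 1 \<le> layer \<gamma> \<epsilon> a"
  by (auto simp: layer_def)

text \<open>\<open>min_principle\<close> is applied to \<open>p - z\<close> and \<open>p + z\<close>
  for a barrier \<open>p\<close> that is a multiple of the right-hand bound. In the factor
  \<open>1 + 2 / \<gamma>\<^sup>2\<close> the first summand dominates the boundary values, the
  second the right-hand side. The weight \<open>w\<close> will be
  \<open>1 / \<epsilon> ^ j\<close>.\<close>

lemma comparison_layer:
  fixes z z1 z2 c :: "real \<Rightarrow> real" and \<epsilon> \<gamma> :: real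
  assumes d1: "\<And>x. x \<in> {0..1} \<Longrightarrow> (z has_real_derivative z1 x) (at x within {0..1})"
    and d2: "\<And>x. x \<in> {0..1} \<Longrightarrow> (z1 has_real_derivative z2 x) (at x within {0..1})"
    and L: "\<And>x. x \<in> {0..1} \<Longrightarrow> \<bar>- (\<epsilon>\<^sup>2 * z2 x) + c x * z x\<bar> \<le> K * (1 + w * layer \<gamma> \<epsilon> x)"
    and c: "\<And>x. x \<in> {0..1} \<Longrightarrow> \<gamma>\<^sup>2 \<le> c x"
    and pos: "0 < \<epsilon>" "0 < \<gamma>" "0 \<le> K" "0 \<le> w"
    and bd: "\<And>a. a \<in> {0, 1} \<Longrightarrow> \<bar>z a\<bar> \<le> K * w"
    and x: "x \<in> {0..1}"
  shows "\<bar>z x\<bar> \<le> K * (1 + 2 / \<gamma>\<^sup>2) * (1 + w * layer \<gamma> \<epsilon> x)"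
proof -
  define A b where "A = K * (1 + 2 / \<gamma>\<^sup>2)" and "b = \<gamma> / (2 * \<epsilon>)"
  define E1 E2 where "E1 = (\<lambda>x. exp (- (b * x)))" and "E2 = (\<lambda>x. exp (- (b * (1 - x))))"
  define p where "p = (\<lambda>x. A * (1 + w * (E1 x + E2 x)))"
  define p1 where "p1 = (\<lambda>x. A * w * (- b * E1 x + b * E2 x))"
  define p2 where "p2 = (\<lambda>x. A * w * (b\<^sup>2 * E1 x + b\<^sup>2 * E2 x))"
  have lay: "layer \<gamma> \<epsilon> x = E1 x + E2 x" for x
    by (simp add: layer_def E1_def E2_def b_def)
  have A: "0 \<le> A" "K \<le> A" using pos by (auto simp: A_def algebra_simps)
  have A2: "2 * K \<le> A * \<gamma>\<^sup>2" using pos by (simp add: A_def algebra_simps)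
  have E: "E1 x > 0" "E2 x > 0" for x by (simp_all add: E1_def E2_def)
  have dp: "(p has_real_derivative p1 x) (at x within S)" for x S
    unfolding p_def p1_def E1_def E2_def by (auto intro!: derivative_eq_intros simp: algebra_simps)
  have dp1: "(p1 has_real_derivative p2 x) (at x within S)" for x S
    unfolding p1_def p2_def E1_def E2_def
    by (auto intro!: derivative_eq_intros simp: algebra_simps power2_eq_square)
  have eb: "\<epsilon>\<^sup>2 * b\<^sup>2 = \<gamma>\<^sup>2 / 4" using pos by (simp add: b_def power_divide power_mult_distrib)
  \<comment> \<open>The halved exponent gives
    \<open>\<epsilon>\<^sup>2 * p2 x = A * \<gamma>\<^sup>2 * s / 4\<close>, against at least
    \<open>A * \<gamma>\<^sup>2 * (1 + s)\<close> from the reaction term. At least three quarters of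
    the latter survive, and \<open>2 * K \<le> A * \<gamma>\<^sup>2\<close> finishes.\<close>
  have Lp: "K * (1 + w * (E1 x + E2 x)) \<le> - (\<epsilon>\<^sup>2 * p2 x) + c x * p x" if "x \<in> {0..1}" for x
  proof -
    define s where "s = w * (E1 x + E2 x)"
    have s: "0 \<le> s" using pos E[of x] by (simp add: s_def)
    have "\<epsilon>\<^sup>2 * p2 x = (\<epsilon>\<^sup>2 * b\<^sup>2) * (A * s)" by (simp add: p2_def s_def algebra_simps)
    then have 1: "\<epsilon>\<^sup>2 * p2 x = A * \<gamma>\<^sup>2 * s / 4" by (simp add: eb)
    have 2: "\<gamma>\<^sup>2 * (A * (1 + s)) \<le> c x * p x"
      unfolding p_def s_def[symmetric] using c[OF that] A s by (intro mult_right_mono) auto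
    have "2 * K * (1 + s) \<le> A * \<gamma>\<^sup>2 * (1 + s)" using A2 s by (intro mult_right_mono) auto
    moreover have "0 \<le> A * \<gamma>\<^sup>2 * s" using A s by simp
    moreover have "0 \<le> A * \<gamma>\<^sup>2" using A by simp
    ultimately show ?thesis using 1 2 unfolding s_def[symmetric] by (simp add: algebra_simps)
  qed
  have cpos: "0 < c x" if "x \<in> {0<..<1}" for x
    using c[of x] that pos by (smt (verit) atLeastAtMost_iff greaterThanLessThan_iff zero_less_power)
  have bp: "K * w \<le> p a" if "a \<in> {0, 1}" for a
  proof -
    have "1 \<le> E1 a + E2 a" using layer_endpoint[OF that, of \<gamma> \<epsilon>] lay by simp
    then have "w * 1 \<le> w * (E1 a + E2 a)" using pos by (intro mult_left_mono) auto
    then show ?thesis unfolding p_def using A pos by (intro mult_mono) auto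
  qed
  have "0 \<le> p x + (-1) * z x"
  proof (rule min_principle[where z = "\<lambda>x. p x + (-1) * z x" and x = x and ?z1.0 = "\<lambda>x. p1 x + (-1) * z1 x" and ?z2.0 = "\<lambda>x. p2 x + (-1) * z2 x" and c = c and \<epsilon> = \<epsilon>])
    fix y :: real
    show "0 \<le> - (\<epsilon>\<^sup>2 * (p2 y + - 1 * z2 y)) + c y * (p y + - 1 * z y)" if "y \<in> {0<..<1}"
      using Lp[of y] L[of y] that lay[of y] by (simp add: algebra_simps)
  qed (use bd[of 0] bd[of 1] bp[of 0] bp[of 1] pos cpos x
       in \<open>auto intro!: DERIV_add DERIV_diff dp dp1 d1 d2\<close>)
  moreover have "0 \<le> p x + z x"
  proof (rule min_principle[where z = "\<lambda>x. p x + z x" and x = x and ?z1.0 = "\<lambda>x. p1 x + z1 x" and ?z2.0 = "\<lambda>x. p2 x + z2 x" and c = c and \<epsilon> = \<epsilon>])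
    fix y :: real
    show "0 \<le> - (\<epsilon>\<^sup>2 * (p2 y + z2 y)) + c y * (p y + z y)" if "y \<in> {0<..<1}"
      using Lp[of y] L[of y] that lay[of y] by (simp add: algebra_simps)
  qed (use bd[of 0] bd[of 1] bp[of 0] bp[of 1] pos cpos x
       in \<open>auto intro!: DERIV_add DERIV_diff dp dp1 d1 d2\<close>)
  ultimately show ?thesis unfolding p_def A_def lay by (simp add: abs_le_iff)
qed

section \<open>Derivatives of the exact solution\<close>

lemma Leibniz_sum_has_derivative:
  fixes A B :: "nat \<Rightarrow> real \<Rightarrow> real"
  assumes A: "\<And>i. i \<le> n \<Longrightarrow> (A i has_real_derivative A (Suc i) x) (at x within S)"
    and B: "\<And>i. i \<le> n \<Longrightarrow> (B i has_real_derivative B (Suc i) x) (at x within S)"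
  shows "((\<lambda>x. \<Sum>i\<le>n. real (n choose i) * A (n - i) x * B i x) has_real_derivative
           (\<Sum>i\<le>Suc n. real (Suc n choose i) * A (Suc n - i) x * B i x)) (at x within S)"
proof -
  let ?a = "\<lambda>i. real (n choose i) * A (Suc n - i) x * B i x"
  let ?b = "\<lambda>i. real (n choose i) * A (n - i) x * B (Suc i) x"
  have "((\<lambda>x. \<Sum>i\<le>n. real (n choose i) * A (n - i) x * B i x) has_real_derivative
           (\<Sum>i\<le>n. ?a i + ?b i)) (at x within S)"
  proof (rule DERIV_sum)
    fix i assume "i \<in> {..n}"
    then have i: "i \<le> n" "n - i \<le> n" "Suc n - i = Suc (n - i)" by auto
    show "((\<lambda>x. real (n choose i) * A (n - i) x * B i x) has_real_derivative ?a i + ?b i) (at x within S)"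
      using A[OF i(2)] B[OF i(1)] i(3) by (auto intro!: derivative_eq_intros simp: algebra_simps)
  qed
  also have "(\<Sum>i\<le>n. ?a i + ?b i) = (\<Sum>i\<le>Suc n. real (Suc n choose i) * A (Suc n - i) x * B i x)"
  proof -
    \<comment> \<open>The extra term has the coefficient \<open>n choose Suc n\<close>, which is 0.
      After the shift both sums run over the same products, and Pascal's rule combines their
      coefficients.\<close>
    have "(\<Sum>i\<le>n. ?a i) = (\<Sum>i\<le>Suc n. ?a i)" by simp
    also have "\<dots> = ?a 0 + (\<Sum>i\<le>n. ?a (Suc i))" by (rule sum.atMost_Suc_shift)
    finally have "(\<Sum>i\<le>n. ?a i) = A (Suc n) x * B 0 x + (\<Sum>i\<le>n. real (n choose Suc i) * A (n - i) x * B (Suc i) x)"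
      by simp
    then show ?thesis
      unfolding sum.atMost_Suc_shift[of _ n]
      by (simp add: sum.distrib algebra_simps)
  qed
  finally show ?thesis .
qed

text \<open>Entries from index 2 on are obtained by differentiating \<open>\<epsilon>\<^sup>2 u'' = c u - f\<close>.\<close>

fun rd_deriv :: "(nat \<Rightarrow> real \<Rightarrow> real) \<Rightarrow> (nat \<Rightarrow> real \<Rightarrow> real) \<Rightarrow> real \<Rightarrow>
    (real \<Rightarrow> real) \<Rightarrow> (real \<Rightarrow> real) \<Rightarrow> nat \<Rightarrow> real \<Rightarrow> real" where
  "rd_deriv C F \<epsilon> u u1 0 = u"
| "rd_deriv C F \<epsilon> u u1 (Suc 0) = u1"
| "rd_deriv C F \<epsilon> u u1 (Suc (Suc n)) =
     (\<lambda>x. ((\<Sum>i\<le>n. real (n choose i) * C (n - i) x * rd_deriv C F \<epsilon> u u1 i x) - F n x) / \<epsilon>\<^sup>2)"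

text \<open>\<open>C\<close> and \<open>F\<close> list the successive derivatives of the reaction
  coefficient and of the source. Neither \<epsilon> nor the solution is fixed here, so constants
  obtained inside the locale are uniform in both.\<close>

locale rd_data =
  fixes C F :: "nat \<Rightarrow> real \<Rightarrow> real" and \<gamma> :: real
  assumes C_deriv: "x \<in> {0..1} \<Longrightarrow> (C n has_real_derivative C (Suc n) x) (at x within {0..1})"
    and F_deriv: "x \<in> {0..1} \<Longrightarrow> (F n has_real_derivative F (Suc n) x) (at x within {0..1})"
    and \<gamma>_pos: "0 < \<gamma>"
    and C_ge: "x \<in> {0..1} \<Longrightarrow> \<gamma>\<^sup>2 \<le> C 0 x"
begin

text \<open>The equation is imposed up to the end points, so that it can be differentiated on the
  closed interval. With \<epsilon> \<le> 1 the powers \<open>1 / \<epsilon> ^ j\<close> increase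
  with \<open>j\<close>.\<close>

definition sol :: "real \<Rightarrow> (real \<Rightarrow> real) \<Rightarrow> (real \<Rightarrow> real) \<Rightarrow> bool" where
  "sol \<epsilon> u u1 \<longleftrightarrow> 0 < \<epsilon> \<and> \<epsilon> \<le> 1 \<and> u 0 = 0 \<and> u 1 = 0 \<and>
     (\<forall>x\<in>{0..1}. (u has_real_derivative u1 x) (at x within {0..1}) \<and>
        (u1 has_real_derivative (C 0 x * u x - F 0 x) / \<epsilon>\<^sup>2) (at x within {0..1}))"

lemma bounded_C: "\<exists>K\<ge>0. \<forall>x\<in>{0..1}. \<bar>C n x\<bar> \<le> K"
  and bounded_F: "\<exists>K\<ge>0. \<forall>x\<in>{0..1}. \<bar>F n x\<bar> \<le> K"
proof -
  have *: "\<exists>K\<ge>0. \<forall>x\<in>{0..1}. \<bar>g x\<bar> \<le> K" if "continuous_on {0..1} g" for g :: "real \<Rightarrow> real"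
  proof -
    have "bounded (g ` {0..1})"
      using that compact_continuous_image compact_imp_bounded by blast
    then obtain K where "\<forall>y\<in>g ` {0..1}. norm y \<le> K" unfolding bounded_iff by blast
    then show ?thesis by (intro exI[of _ "max K 0"]) force
  qed
  show "\<exists>K\<ge>0. \<forall>x\<in>{0..1}. \<bar>C n x\<bar> \<le> K"
    by (rule *) (use C_deriv DERIV_continuous_on in blast)
  show "\<exists>K\<ge>0. \<forall>x\<in>{0..1}. \<bar>F n x\<bar> \<le> K"
    by (rule *) (use F_deriv DERIV_continuous_on in blast)
qed

text \<open>Entry \<open>n + 2\<close> is built from all entries up to \<open>n\<close>, hence
  strong induction; the Leibniz rule shows that differentiating the recursion reproduces it one
  order higher.\<close>

lemma rd_deriv_has_derivative:
  assumes "sol \<epsilon> u u1" and x: "x \<in> {0..1}"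
  shows "(rd_deriv C F \<epsilon> u u1 n has_real_derivative rd_deriv C F \<epsilon> u u1 (Suc n) x) (at x within {0..1})"
proof (induction n rule: less_induct)
  case (less n)
  consider "n = 0" | "n = 1" | m where "n = Suc (Suc m)"
    by (metis One_nat_def not0_implies_Suc)
  then show ?case
  proof cases
    case 3
    have "((\<lambda>x. ((\<Sum>i\<le>m. real (m choose i) * C (m - i) x * rd_deriv C F \<epsilon> u u1 i x) - F m x) / \<epsilon>\<^sup>2)
       has_real_derivative ((\<Sum>i\<le>Suc m. real (Suc m choose i) * C (Suc m - i) x * rd_deriv C F \<epsilon> u u1 i x)
        - F (Suc m) x) / \<epsilon>\<^sup>2) (at x within {0..1})"
      using less 3 C_deriv[OF x] F_deriv[OF x]
      by (intro DERIV_cdivide DERIV_diff Leibniz_sum_has_derivative) auto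
    then show ?thesis unfolding 3 rd_deriv.simps .
  qed (use assms in \<open>auto simp: sol_def\<close>)
qed

text \<open>This supplies the boundary value of the first derivative, which neither the boundary
  conditions nor the equation gives directly. A Taylor step of length \<epsilon> balances the second
  derivative, of size \<open>L / \<epsilon>\<^sup>2\<close>, against the bound on
  \<open>u\<close>.\<close>

lemma first_deriv_endpoint:
  assumes s: "sol \<epsilon> u u1" and a: "a \<in> {0, 1}" and K: "\<And>x. x \<in> {0..1} \<Longrightarrow> \<bar>u x\<bar> \<le> K"
    and L: "\<And>x. x \<in> {0..1} \<Longrightarrow> \<bar>C 0 x * u x - F 0 x\<bar> \<le> L"
  shows "\<bar>u1 a\<bar> \<le> (K + L) / \<epsilon>"
proof -
  have e: "0 < \<epsilon>" "\<epsilon> \<le> 1" using s by (auto simp: sol_def)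
  define y where "y = (if a = 0 then \<epsilon> else 1 - \<epsilon>)"
  have y: "y \<in> {0..1}" "\<bar>y - a\<bar> = \<epsilon>" using e a by (auto simp: y_def)
  have "norm (rd_deriv C F \<epsilon> u u1 0 y - (\<Sum>i\<le>1. rd_deriv C F \<epsilon> u u1 i a * (y - a) ^ i / fact i))
      \<le> (L / \<epsilon>\<^sup>2) * norm (y - a) ^ (Suc 1) / fact 1"
  proof (rule field_Taylor[of "{0..1}"])
    show "norm (rd_deriv C F \<epsilon> u u1 (Suc 1) x) \<le> L / \<epsilon>\<^sup>2" if "x \<in> {0..1}" for x
      using L[OF that] e by (simp add: divide_right_mono)
  qed (use a y rd_deriv_has_derivative[OF s] in auto)
  moreover have "u a = 0" using s a by (auto simp: sol_def)
  ultimately have "\<bar>u y - u1 a * (y - a)\<bar> \<le> L"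
    using y e by (simp add: power2_eq_square)
  then have "\<bar>u1 a * (y - a)\<bar> \<le> K + L" using K[OF y(1)] by linarith
  then have "\<bar>u1 a\<bar> * \<epsilon> \<le> K + L" by (simp only: abs_mult y(2))
  then show ?thesis using e by (simp add: pos_le_divide_eq)
qed

text \<open>Induction on the order: the differentiated equation keeps the operator and moves lower
  derivatives to the right-hand side, so boundary values and \<open>comparison_layer\<close>
  suffice. The constant is chosen before \<epsilon> and the solution.\<close>

lemma deriv_bound:
  "\<exists>K\<ge>0. \<forall>\<epsilon> u u1. sol \<epsilon> u u1 \<longrightarrow>
     (\<forall>x\<in>{0..1}. \<bar>rd_deriv C F \<epsilon> u u1 j x\<bar> \<le> K * (1 + layer \<gamma> \<epsilon> x / \<epsilon> ^ j))"
proof (induction j rule: less_induct)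
  case (less j)
  from less obtain B where B0: "\<And>i. i < j \<Longrightarrow> 0 \<le> B i"
    and B: "\<And>i \<epsilon> u u1 x. i < j \<Longrightarrow> sol \<epsilon> u u1 \<Longrightarrow> x \<in> {0..1} \<Longrightarrow>
       \<bar>rd_deriv C F \<epsilon> u u1 i x\<bar> \<le> B i * (1 + layer \<gamma> \<epsilon> x / \<epsilon> ^ i)"
    by metis
  obtain KC where KC0: "\<And>n. 0 \<le> KC n" and KC: "\<And>n x. x \<in> {0..1} \<Longrightarrow> \<bar>C n x\<bar> \<le> KC n"
    using bounded_C by metis
  obtain KF where KF0: "\<And>n. 0 \<le> KF n" and KF: "\<And>n x. x \<in> {0..1} \<Longrightarrow> \<bar>F n x\<bar> \<le> KF n"
    using bounded_F by metis
  \<comment> \<open>Removing the index \<open>j\<close> has an effect only for \<open>n = j\<close>,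
    where the top-order term belongs to the operator. For \<open>n < j\<close> the sum is the full
    Leibniz sum, which is what the boundary values require.\<close>
  define S where "S n = KF n + (\<Sum>i\<in>{..n} - {j}. real (n choose i) * KC (n - i) * B i)" for n
  have Sbound: "\<bar>(\<Sum>i\<in>{..n} - {j}. real (n choose i) * C (n - i) x * rd_deriv C F \<epsilon> u u1 i x) - F n x\<bar>
      \<le> S n * (1 + layer \<gamma> \<epsilon> x / \<epsilon> ^ n)" if n: "n \<le> j" and s: "sol \<epsilon> u u1" and x: "x \<in> {0..1}" for \<epsilon> u u1 x n
  proof -
    let ?w = "1 + layer \<gamma> \<epsilon> x / \<epsilon> ^ n"
    have e: "0 < \<epsilon>" "\<epsilon> \<le> 1" using s by (auto simp: sol_def)
    have w1: "1 \<le> ?w" using layer_nonneg e by simp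
    have "\<bar>real (n choose i) * C (n - i) x * rd_deriv C F \<epsilon> u u1 i x\<bar>
        \<le> real (n choose i) * KC (n - i) * B i * ?w" if i: "i \<in> {..n} - {j}" for i
    proof -
      have ij: "i < j" "i \<le> n" using i n by auto
      have "layer \<gamma> \<epsilon> x / \<epsilon> ^ i \<le> layer \<gamma> \<epsilon> x / \<epsilon> ^ n"
        using e ij layer_nonneg by (intro divide_left_mono power_decreasing) auto
      then have "\<bar>rd_deriv C F \<epsilon> u u1 i x\<bar> \<le> B i * ?w"
        using B[OF ij(1) s x] B0[OF ij(1)]
        by (meson add_left_mono mult_left_mono order_trans)
      then show ?thesis unfolding abs_mult mult.assoc
        using KC[OF x] KC0 by (intro mult_mono) auto
    qed
    then have "\<bar>\<Sum>i\<in>{..n} - {j}. real (n choose i) * C (n - i) x * rd_deriv C F \<epsilon> u u1 i x\<bar>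
        \<le> (\<Sum>i\<in>{..n} - {j}. real (n choose i) * KC (n - i) * B i * ?w)"
      by (rule order_trans[OF sum_abs sum_mono])
    moreover have "KF n * 1 \<le> KF n * ?w" using KF0 w1 by (intro mult_left_mono) auto
    ultimately show ?thesis using KF[OF x, of n]
      unfolding S_def distrib_right[of "KF n"] sum_distrib_right by linarith
  qed
  have S0: "0 \<le> S n" if "n \<le> j" for n
    unfolding S_def using that B0 KC0 KF0 by (intro add_nonneg_nonneg sum_nonneg) auto
  have "\<exists>K\<ge>0. \<forall>\<epsilon> u u1 a. sol \<epsilon> u u1 \<and> a \<in> {0, 1} \<longrightarrow> \<bar>rd_deriv C F \<epsilon> u u1 j a\<bar> \<le> K / \<epsilon> ^ j"
  proof -
    consider "j = 0" | "j = 1" | m where "j = Suc (Suc m)"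
      by (metis One_nat_def not0_implies_Suc)
    then show ?thesis
    proof cases
      case 1
      then show ?thesis by (intro exI[of _ 0]) (auto simp: sol_def)
    next
      case 2
      \<comment> \<open>The factors 3 bound \<open>1 + layer\<close>, since each of the two
        exponentials is at most 1.\<close>
      have "\<bar>u1 a\<bar> \<le> (3 * B 0 + 3 * S 0) / \<epsilon>" if s: "sol \<epsilon> u u1" and a: "a \<in> {0, 1}" for \<epsilon> u u1 a
      proof (rule first_deriv_endpoint[OF s a])
        fix x :: real assume x: "x \<in> {0..1}"
        have l: "layer \<gamma> \<epsilon> x \<le> 2" using layer_le_2[OF \<gamma>_pos _ x] s by (auto simp: sol_def)
        have "\<bar>u x\<bar> \<le> B 0 * (1 + layer \<gamma> \<epsilon> x)" using B[of 0, OF _ s x] 2 by simp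
        also have "\<dots> \<le> B 0 * 3" using l B0[of 0] 2 by (intro mult_left_mono) auto
        finally show "\<bar>u x\<bar> \<le> 3 * B 0" by simp
        have "\<bar>C 0 x * u x - F 0 x\<bar> \<le> S 0 * (1 + layer \<gamma> \<epsilon> x)" using Sbound[of 0, OF _ s x] 2 by simp
        also have "\<dots> \<le> S 0 * 3" using l S0[of 0] 2 by (intro mult_left_mono) auto
        finally show "\<bar>C 0 x * u x - F 0 x\<bar> \<le> 3 * S 0" by simp
      qed
      then show ?thesis using 2 B0[of 0] S0[of 0] by (intro exI[of _ "3 * B 0 + 3 * S 0"]) auto
    next
      case 3
      \<comment> \<open>From order 2 on the recursion expresses the value through orders at most
        \<open>m = j - 2\<close>; its division by \<epsilon>^2 turns
        \<open>1 / \<epsilon> ^ m\<close> into \<open>1 / \<epsilon> ^ j\<close>.\<close>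
      have "\<bar>rd_deriv C F \<epsilon> u u1 j a\<bar> \<le> (3 * S m) / \<epsilon> ^ j" if s: "sol \<epsilon> u u1" and a: "a \<in> {0, 1}" for \<epsilon> u u1 a
      proof -
        have x: "a \<in> {0..1}" using a by auto
        have e: "0 < \<epsilon>" "\<epsilon> \<le> 1" using s by (auto simp: sol_def)
        have e1: "1 \<le> 1 / \<epsilon> ^ m" using e by (simp add: power_le_one)
        have l: "layer \<gamma> \<epsilon> a \<le> 2" using layer_le_2[OF \<gamma>_pos e(1) x] .
        have [simp]: "{..m} - {j} = {..m}" using 3 by auto
        have "1 + layer \<gamma> \<epsilon> a / \<epsilon> ^ m \<le> 1 / \<epsilon> ^ m + 2 / \<epsilon> ^ m"
          using l e e1 by (intro add_mono divide_right_mono) auto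
        also have "\<dots> = 3 / \<epsilon> ^ m" by (simp add: add_divide_distrib[symmetric])
        finally have "S m * (1 + layer \<gamma> \<epsilon> a / \<epsilon> ^ m) \<le> S m * (3 / \<epsilon> ^ m)"
          using S0[of m] 3 by (intro mult_left_mono) auto
        then have "\<bar>(\<Sum>i\<le>m. real (m choose i) * C (m - i) a * rd_deriv C F \<epsilon> u u1 i a) - F m a\<bar>
            \<le> S m * (3 / \<epsilon> ^ m)"
          using Sbound[of m, OF _ s x] 3 by (simp del: times_divide_eq_right)
        then have "\<bar>(\<Sum>i\<le>m. real (m choose i) * C (m - i) a * rd_deriv C F \<epsilon> u u1 i a) - F m a\<bar> / \<epsilon>\<^sup>2
            \<le> S m * (3 / \<epsilon> ^ m) / \<epsilon>\<^sup>2" by (rule divide_right_mono) simp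
        then show ?thesis using e by (simp add: 3 power2_eq_square mult_ac)
      qed
      then show ?thesis using S0[of m] 3 by (intro exI[of _ "3 * S m"]) auto
    qed
  qed
  then obtain K where K0: "0 \<le> K" and K: "\<And>\<epsilon> u u1 a. sol \<epsilon> u u1 \<Longrightarrow> a \<in> {0, 1} \<Longrightarrow>
      \<bar>rd_deriv C F \<epsilon> u u1 j a\<bar> \<le> K / \<epsilon> ^ j" by blast
  show ?case
  proof (intro exI[of _ "(K + S j) * (1 + 2 / \<gamma>\<^sup>2)"] conjI allI impI ballI)
    show "0 \<le> (K + S j) * (1 + 2 / \<gamma>\<^sup>2)" using K0 S0[of j] by simp
    fix \<epsilon> u u1 and x :: real
    assume s: "sol \<epsilon> u u1" and x: "x \<in> {0..1}"
    have e: "0 < \<epsilon>" "\<epsilon> \<le> 1" using s by (auto simp: sol_def)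
    have "\<bar>rd_deriv C F \<epsilon> u u1 j x\<bar> \<le> (K + S j) * (1 + 2 / \<gamma>\<^sup>2) * (1 + (1 / \<epsilon> ^ j) * layer \<gamma> \<epsilon> x)"
    proof (rule comparison_layer[OF rd_deriv_has_derivative[OF s] rd_deriv_has_derivative[OF s] _ C_ge])
      fix y :: real assume y: "y \<in> {0..1}"
      let ?G = "\<lambda>i. real (j choose i) * C (j - i) y * rd_deriv C F \<epsilon> u u1 i y"
      \<comment> \<open>Splitting off \<open>i = j\<close> isolates \<open>C 0 y\<close> times the
        derivative being estimated; what is left involves only lower orders.\<close>
      have "(\<Sum>i\<le>j. ?G i) = ?G j + (\<Sum>i\<in>{..j} - {j}. ?G i)"
        by (rule sum.remove) auto
      moreover have "\<epsilon>\<^sup>2 * rd_deriv C F \<epsilon> u u1 (Suc (Suc j)) y = (\<Sum>i\<le>j. ?G i) - F j y"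
        using e by simp
      ultimately have "\<bar>- (\<epsilon>\<^sup>2 * rd_deriv C F \<epsilon> u u1 (Suc (Suc j)) y) + C 0 y * rd_deriv C F \<epsilon> u u1 j y\<bar>
          = \<bar>(\<Sum>i\<in>{..j} - {j}. ?G i) - F j y\<bar>" by (simp del: rd_deriv.simps)
      also have "\<dots> \<le> S j * (1 + layer \<gamma> \<epsilon> y / \<epsilon> ^ j)" using Sbound[OF _ s y, of j] by simp
      also have "\<dots> \<le> (K + S j) * (1 + (1 / \<epsilon> ^ j) * layer \<gamma> \<epsilon> y)"
        using K0 S0[of j] e layer_nonneg by (intro mult_mono) auto
      finally show "\<bar>- (\<epsilon>\<^sup>2 * rd_deriv C F \<epsilon> u u1 (Suc (Suc j)) y) + C 0 y * rd_deriv C F \<epsilon> u u1 j y\<bar>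
          \<le> (K + S j) * (1 + (1 / \<epsilon> ^ j) * layer \<gamma> \<epsilon> y)" .
    next
      fix a :: real assume "a \<in> {0, 1}"
      from K[OF s this] show "\<bar>rd_deriv C F \<epsilon> u u1 j a\<bar> \<le> (K + S j) * (1 / \<epsilon> ^ j)"
        using S0[of j] e divide_right_mono[of K "K + S j" "\<epsilon> ^ j"] by auto
    qed (use K0 S0[of j] e \<gamma>_pos x in auto)
    then show "\<bar>rd_deriv C F \<epsilon> u u1 j x\<bar> \<le> (K + S j) * (1 + 2 / \<gamma>\<^sup>2) * (1 + layer \<gamma> \<epsilon> x / \<epsilon> ^ j)"
      by simp
  qed
qed

end

section \<open>Extending the equation to the end points\<close>

text \<open>The equation fixes the second derivative only in the interior. Writing \<open>u1\<close>
  as the integral of the continuous function \<open>g\<close> recovers the derivative at both ends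
  as well.\<close>

lemma second_derivative_closed:
  fixes u1 u2 g :: "real \<Rightarrow> real"
  assumes u1: "\<And>x. x \<in> {a..b} \<Longrightarrow> (u1 has_real_derivative u2 x) (at x within {a..b})"
    and g: "continuous_on {a..b} g" and eq: "\<And>x. x \<in> {a<..<b} \<Longrightarrow> u2 x = g x"
    and x: "x \<in> {a..b}"
  shows "(u1 has_real_derivative g x) (at x within {a..b})"
proof -
  have "u1 y = u1 a + integral {a..y} g" if y: "y \<in> {a..b}" for y
  proof -
    have "(g has_integral u1 y - u1 a) {a..y}"
    proof (rule fundamental_theorem_of_calculus_interior)
      show "continuous_on {a..y} u1"
        by (rule continuous_on_subset[of "{a..b}"]) (use DERIV_continuous_on[OF u1] y in auto)
      show "(u1 has_vector_derivative g t) (at t)" if "t \<in> {a<..<y}" for t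
        using u1[of t] eq[of t] that y at_within_Icc_at[of a t b]
        by (auto simp: has_real_derivative_iff_has_vector_derivative)
    qed (use y in auto)
    then show ?thesis by (simp add: integral_unique)
  qed
  note eq_int = this
  have "((\<lambda>y. u1 a + integral {a..y} g) has_real_derivative g x) (at x within {a..b})"
    using DERIV_add[OF DERIV_const integral_has_real_derivative[OF g x]] by simp
  then show ?thesis
    by (rule has_field_derivative_transform_within[where d = 1]) (use x in \<open>auto simp del: atLeastAtMost_iff intro: eq_int[symmetric]\<close>)
qed

section \<open>Interpolation and mesh geometry\<close>

text \<open>The Taylor polynomial at the left end point, corrected by a linear function so that it also
  interpolates at the right end point.\<close>

lemma ex_endpoint_interpolant:
  fixes U :: "nat \<Rightarrow> real \<Rightarrow> real"
  assumes ab: "a < b" and k: "1 \<le> k"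
    and U: "\<And>n x. x \<in> {a..b} \<Longrightarrow> (U n has_real_derivative U (Suc n) x) (at x within {a..b})"
    and M: "\<And>x. x \<in> {a..b} \<Longrightarrow> \<bar>U (Suc k) x\<bar> \<le> M"
  shows "\<exists>p. degree p \<le> k \<and> poly p a = U 0 a \<and> poly p b = U 0 b \<and>
    (\<forall>t\<in>{a..b}. \<bar>U 0 t - poly p t\<bar> \<le> 2 * M * (b - a) ^ Suc k \<and>
      \<bar>U 1 t - poly (pderiv p) t\<bar> \<le> 2 * M * (b - a) ^ k)"
proof -
  obtain m where m: "k = Suc m" using k by (cases k) auto
  have M0: "0 \<le> M" using M[of a] ab by auto
  define T where "T = (\<Sum>i\<le>k. smult (U i a / fact i) ([:- a, 1:] ^ i))"
  have T: "poly T t = (\<Sum>i\<le>k. U i a * (t - a) ^ i / fact i)" for t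
    by (simp add: T_def poly_sum algebra_simps)
  have degT: "degree T \<le> k"
    unfolding T_def
    by (rule degree_sum_le) (auto intro!: order_trans[OF degree_smult_le] simp: degree_linear_power)
  \<comment> \<open>Uniqueness of derivatives identifies \<open>pderiv T\<close> with the termwise
    derivative. After an index shift this is the Taylor polynomial of \<open>U 1\<close> of degree
    \<open>k - 1\<close>, to which the same remainder bound applies.\<close>
  have "((\<lambda>t. \<Sum>i\<le>k. U i a * (t - a) ^ i / fact i) has_real_derivative
      (\<Sum>i\<le>k. U i a * (real i * (t - a) ^ (i - 1)) / fact i)) (at t)" for t
    by (intro DERIV_sum) (auto intro!: derivative_eq_intros)
  then have "poly (pderiv T) t = (\<Sum>i\<le>k. U i a * (real i * (t - a) ^ (i - 1)) / fact i)" for t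
    using poly_DERIV[of T t] unfolding T[abs_def] by (rule DERIV_unique[symmetric])
  then have T': "poly (pderiv T) t = (\<Sum>i\<le>m. U (Suc i) a * (t - a) ^ i / fact i)" for t
    unfolding m sum.atMost_Suc_shift
    by (auto intro!: sum.cong simp del: of_nat_Suc)
  have E0: "\<bar>U 0 t - poly T t\<bar> \<le> M * (b - a) ^ Suc k" if t: "t \<in> {a..b}" for t
  proof -
    have "norm (U 0 t - poly T t) \<le> M * norm (t - a) ^ Suc k / fact k"
      unfolding T by (rule field_Taylor[of "{a..b}"]) (use ab t U M in auto)
    also have "\<dots> \<le> M * norm (t - a) ^ Suc k / 1"
      using M0 by (intro divide_left_mono) (auto simp: fact_ge_1)
    also have "\<dots> \<le> M * (b - a) ^ Suc k"
      using M0 t by (auto intro!: mult_left_mono power_mono simp del: power_Suc)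
    finally show ?thesis by simp
  qed
  have E1: "\<bar>U 1 t - poly (pderiv T) t\<bar> \<le> M * (b - a) ^ k" if t: "t \<in> {a..b}" for t
  proof -
    have "norm ((\<lambda>i. U (Suc i)) 0 t - poly (pderiv T) t) \<le> M * norm (t - a) ^ Suc m / fact m"
      unfolding T' by (rule field_Taylor[of "{a..b}"]) (use ab t U M m in auto)
    also have "\<dots> \<le> M * norm (t - a) ^ Suc m / 1"
      using M0 by (intro divide_left_mono) (auto simp: fact_ge_1)
    also have "\<dots> \<le> M * (b - a) ^ k"
      using M0 t m by (auto intro!: mult_left_mono power_mono simp del: power_Suc)
    finally show ?thesis by simp
  qed
  \<comment> \<open>The slope cancels the mismatch of the Taylor polynomial at \<open>b\<close>. Its
    size is that of the derivative error, so the correction only doubles the constants.\<close>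
  define s where "s = (U 0 b - poly T b) / (b - a)"
  have s: "\<bar>s\<bar> \<le> M * (b - a) ^ k"
    using E0[of b] ab by (simp add: s_def abs_divide field_simps)
  define p where "p = T + smult s [:- a, 1:]"
  have p: "poly p t = poly T t + s * (t - a)" for t by (simp add: p_def algebra_simps)
  have p': "poly (pderiv p) t = poly (pderiv T) t + s" for t
    by (simp add: p_def pderiv_add pderiv_smult pderiv_pCons)
  show ?thesis
  proof (intro exI[of _ p] conjI ballI)
    show "degree p \<le> k" unfolding p_def using degT k
      by (intro degree_add_le order_trans[OF degree_smult_le]) auto
    show "poly p a = U 0 a" unfolding p T m sum.atMost_Suc_shift by simp
    show "poly p b = U 0 b" using ab by (simp add: p s_def)
    fix t assume t: "t \<in> {a..b}"
    have "\<bar>s\<bar> * (t - a) \<le> M * (b - a) ^ k * (b - a)"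
      using s t M0 ab by (intro mult_mono) auto
    then have "\<bar>s * (t - a)\<bar> \<le> M * (b - a) ^ Suc k" using t by (simp add: abs_mult mult_ac)
    then show "\<bar>U 0 t - poly p t\<bar> \<le> 2 * M * (b - a) ^ Suc k"
      using E0[OF t] unfolding p by linarith
    show "\<bar>U 1 t - poly (pderiv p) t\<bar> \<le> 2 * M * (b - a) ^ k"
      using E1[OF t] s unfolding p' by linarith
  qed
qed

text \<open>The bound \<open>s + 1 \<le> (1 + 1 / c) * exp (c * s)\<close> is raised to the power
  \<open>n\<close>. The rate \<open>c\<close> has denominator \<open>n + 1\<close>, so that
  \<open>n * c \<le> b\<close> holds also for \<open>n = 0\<close>.\<close>

lemma power_exp_bounded:
  fixes b :: real
  assumes "0 < b"
  shows "\<exists>G\<ge>0. \<forall>s\<ge>0. (s + 1) ^ n * exp (- (b * s)) \<le> G"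
proof (intro exI conjI allI impI)
  define c where "c = b / (real n + 1)"
  have c: "0 < c" and cn: "real n * c \<le> b" using assms by (simp_all add: c_def field_simps)
  show "0 \<le> (1 + 1 / c) ^ n" using c by simp
  fix s :: real assume s: "0 \<le> s"
  have "s + 1 \<le> (1 + 1 / c) * (1 + c * s)" using c s by (simp add: field_simps)
  also have "\<dots> \<le> (1 + 1 / c) * exp (c * s)" using c by (intro mult_left_mono) auto
  finally have "(s + 1) ^ n \<le> ((1 + 1 / c) * exp (c * s)) ^ n" using s by (intro power_mono) auto
  also have "\<dots> = (1 + 1 / c) ^ n * exp ((real n * c) * s)"
    by (simp add: power_mult_distrib exp_of_nat_mult mult.assoc)
  also have "\<dots> \<le> (1 + 1 / c) ^ n * exp (b * s)"
    using c cn s by (intro mult_left_mono) (auto intro: mult_right_mono)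
  finally show "(s + 1) ^ n * exp (- (b * s)) \<le> (1 + 1 / c) ^ n"
    by (simp add: exp_minus field_simps)
qed

section \<open>Geometry of the Duran-Lombardi mesh\<close>

text \<open>The uniform part of the mesh ends between \<open>\<epsilon> / 2\<close> and \<epsilon>:
  the product \<open>dl_ell H * H\<close> exceeds \<open>1 - H\<close> and is at least
  \<open>H\<close>, and one of these is at least 1/2.\<close>

lemma dl_ell_bounds:
  assumes "0 < H" "H < 1"
  shows "1 \<le> dl_ell H" "real (dl_ell H) * H \<le> 1" "1 / 2 \<le> real (dl_ell H) * H"
proof -
  have 1: "1 \<le> 1 / H" using assms by simp
  then have "1 \<le> \<lfloor>1 / H\<rfloor>" by (simp only: one_le_floor)
  then have r: "real (dl_ell H) = of_int \<lfloor>1 / H\<rfloor>" and l1: "1 \<le> dl_ell H"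
    unfolding dl_ell_def by linarith+
  from l1 show "1 \<le> dl_ell H" .
  have "real (dl_ell H) \<le> 1 / H" unfolding r by linarith
  then show "real (dl_ell H) * H \<le> 1" using assms by (simp add: field_simps)
  have "1 / H < real (dl_ell H) + 1" unfolding r by linarith
  then have "1 < real (dl_ell H) * H + H" using assms by (simp add: field_simps)
  moreover have "1 * H \<le> real (dl_ell H) * H" using l1 assms by (intro mult_right_mono) auto
  ultimately show "1 / 2 \<le> real (dl_ell H) * H" by linarith
qed

lemma dl_base_0 [simp]: "dl_base \<epsilon> H 0 = 0"
  by (simp add: dl_base_def)

lemma dl_base_nonneg: "0 < H \<Longrightarrow> 0 < \<epsilon> \<Longrightarrow> 0 \<le> dl_base \<epsilon> H i"
  by (simp add: dl_base_def)

text \<open>Uniform steps have length \<open>H * \<epsilon>\<close>, geometric ones \<open>H\<close>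
  times the left node. The sum of the two bounds both kinds, so the regimes need no further
  distinction.\<close>

lemma dl_base_step:
  assumes "0 < H" "H < 1" "0 < \<epsilon>"
  shows "dl_base \<epsilon> H i < dl_base \<epsilon> H (Suc i)"
    and "dl_base \<epsilon> H (Suc i) \<le> dl_base \<epsilon> H i + H * (dl_base \<epsilon> H i + \<epsilon>)"
proof -
  let ?l = "dl_ell H"
  have "dl_base \<epsilon> H i < dl_base \<epsilon> H (Suc i) \<and>
        dl_base \<epsilon> H (Suc i) \<le> dl_base \<epsilon> H i + H * (dl_base \<epsilon> H i + \<epsilon>)"
  proof (cases "Suc i \<le> ?l")
    case True
    then show ?thesis using assms by (simp add: dl_base_def algebra_simps)
  next
    case False
    then have i: "?l \<le> i" by simp
    have b: "dl_base \<epsilon> H j = (1 + H) ^ (j - ?l) * (real ?l * H * \<epsilon>)" if "?l \<le> j" for j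
      using that by (auto simp: dl_base_def)
    have "0 < dl_base \<epsilon> H i" unfolding b[OF i] using assms dl_ell_bounds(1)[of H] by simp
    moreover have "dl_base \<epsilon> H (Suc i) = (1 + H) * dl_base \<epsilon> H i"
      using i by (simp add: b Suc_diff_le)
    ultimately show ?thesis using assms by (simp add: algebra_simps)
  qed
  then show "dl_base \<epsilon> H i < dl_base \<epsilon> H (Suc i)"
    "dl_base \<epsilon> H (Suc i) \<le> dl_base \<epsilon> H i + H * (dl_base \<epsilon> H i + \<epsilon>)" by blast+
qed

text \<open>Geometric growth starts at \<open>\<epsilon> / 2\<close> or later and is still below 1/2
  one step before the end, so \<open>(1 + H) ^ j < 1 / \<epsilon>\<close>; the logarithm bounds
  \<open>j * H\<close>. The uniform part and the final step each add at most 1.\<close>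

lemma dl_M_bounds:
  assumes "0 < H" "H < 1" "0 < \<epsilon>" "\<epsilon> < 1 / 4"
  shows "1 / 2 \<le> dl_base \<epsilon> H (dl_M \<epsilon> H)" "i < dl_M \<epsilon> H \<Longrightarrow> dl_base \<epsilon> H i < 1 / 2"
    "2 \<le> dl_M \<epsilon> H" "real (dl_M \<epsilon> H) * H \<le> 2 + 2 * ln (1 / \<epsilon>)"
proof -
  let ?l = "dl_ell H"
  note l = dl_ell_bounds[OF assms(1,2)]
  have b: "dl_base \<epsilon> H j = (1 + H) ^ (j - ?l) * (real ?l * H * \<epsilon>)" if "?l \<le> j" for j
    using that by (auto simp: dl_base_def)
  have ex: "\<exists>m. 1 / 2 \<le> dl_base \<epsilon> H m"
  proof -
    obtain m where "1 / 2 / (real ?l * H * \<epsilon>) < (1 + H) ^ m"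
      using real_arch_pow[of "1 + H"] assms by auto
    then have "1 / 2 \<le> dl_base \<epsilon> H (m + ?l)"
      using assms l by (simp add: b field_simps)
    then show ?thesis by blast
  qed
  then show M: "1 / 2 \<le> dl_base \<epsilon> H (dl_M \<epsilon> H)" unfolding dl_M_def by (rule LeastI_ex)
  show lt: "dl_base \<epsilon> H i < 1 / 2" if "i < dl_M \<epsilon> H" for i
    using not_less_Least[of i "\<lambda>m. 1 / 2 \<le> dl_base \<epsilon> H m"] that unfolding dl_M_def by auto
  have le: "?l * H * \<epsilon> \<le> \<epsilon>" using mult_right_mono[OF l(2), of \<epsilon>] assms by simp
  \<comment> \<open>The uniform part stays below \<epsilon> < 1/4 and cannot reach 1/2.\<close>
  have lM: "?l < dl_M \<epsilon> H"
  proof (rule ccontr)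
    assume "\<not> ?l < dl_M \<epsilon> H"
    then have "dl_M \<epsilon> H \<le> ?l" by simp
    then have "dl_base \<epsilon> H (dl_M \<epsilon> H) = dl_M \<epsilon> H * H * \<epsilon>" "dl_M \<epsilon> H * (H * \<epsilon>) \<le> ?l * (H * \<epsilon>)"
      using assms by (auto simp: dl_base_def intro!: mult_right_mono)
    then show False using M le assms by (simp add: mult.assoc)
  qed
  then show "2 \<le> dl_M \<epsilon> H" using l(1) by simp
  define j where "j = dl_M \<epsilon> H - 1 - ?l"
  have Mj: "dl_M \<epsilon> H = Suc (j + ?l)" using lM by (simp add: j_def)
  have "(1 + H) ^ j * (1 / 2 * \<epsilon>) \<le> (1 + H) ^ j * (?l * H * \<epsilon>)"
    using l assms by (intro mult_left_mono mult_right_mono) auto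
  also have "\<dots> < 1 / 2" using lt[of "j + ?l"] by (simp add: Mj b)
  finally have "(1 + H) ^ j < 1 / \<epsilon>" using assms by (simp add: field_simps)
  then have "ln ((1 + H) ^ j) < ln (1 / \<epsilon>)" using assms by (subst ln_less_cancel_iff) auto
  then have 1: "real j * ln (1 + H) < ln (1 / \<epsilon>)" using assms by (simp add: ln_realpow)
  \<comment> \<open>Applying the logarithm bound to the reciprocal yields the lower estimate
    \<open>H / 2 \<le> ln (1 + H)\<close>, using \<open>H < 1\<close>.\<close>
  have "ln (1 / (1 + H)) \<le> 1 / (1 + H) - 1" using assms by (intro ln_le_minus_one) auto
  moreover have "1 / (1 + H) - 1 \<le> - (H / 2)" using assms by (simp add: field_simps)
  ultimately have "H / 2 \<le> ln (1 + H)" using assms by (simp add: ln_div)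
  then have "real j * (H / 2) \<le> real j * ln (1 + H)" by (intro mult_left_mono) auto
  with 1 have "real j * H \<le> 2 * ln (1 / \<epsilon>)" by simp
  then show "real (dl_M \<epsilon> H) * H \<le> 2 + 2 * ln (1 / \<epsilon>)"
    using l assms unfolding Mj by (simp add: algebra_simps)
qed

text \<open>The number \<open>d\<close> is a lower bound for the distance of the element from the
  boundary: the left node in the left half, its mirror image in the right half. The factor 3 allows
  for the element next to 1/2, which may merge two steps.\<close>

lemma dl_node_properties:
  fixes \<epsilon> H omit
  assumes as: "0 < H" "H < 1" "0 < \<epsilon>" "\<epsilon> < 1 / 4"
  defines "N \<equiv> dl_N \<epsilon> H omit" and "x \<equiv> dl_node \<epsilon> H omit"
  shows "2 \<le> N" "x 0 = 0" "x N = 1" "real N * H \<le> 4 + 4 * ln (1 / \<epsilon>)"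
    and "\<And>i. i \<in> {1..N} \<Longrightarrow> x (i - 1) < x i \<and> 0 \<le> x (i - 1) \<and> x i \<le> 1 \<and>
      (\<exists>d\<ge>0. d \<le> x (i - 1) \<and> d \<le> 1 - x i \<and> x i - x (i - 1) \<le> 3 * H * (d + \<epsilon>))"
proof -
  define m where "m = dl_half \<epsilon> H omit"
  note M = dl_M_bounds[OF as]
  note st = dl_base_step[OF as(1-3)]
  note nn = dl_base_nonneg[OF as(1,3)]
  have m: "1 \<le> m" "m \<le> dl_M \<epsilon> H" using M(3) by (auto simp: m_def dl_half_def)
  have N: "N = 2 * m" by (simp add: N_def dl_N_def m_def)
  \<comment> \<open>With 1/2 as its last value, \<open>y\<close> describes the left half and,
    reflected, the right half; the two descriptions agree at \<open>i = m\<close>.\<close>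
  define y where "y i = (if i < m then dl_base \<epsilon> H i else 1 / 2)" for i
  have xl: "x i = y i" if "i \<le> m" for i
    using that by (auto simp: x_def dl_node_def y_def m_def Let_def)
  have xr: "x i = 1 - y (2 * m - i)" if "m \<le> i" "i \<le> 2 * m" for i
    using that by (auto simp: x_def dl_node_def y_def m_def Let_def)
  have y0: "y 0 = 0" using m by (simp add: y_def)
  show "2 \<le> N" "x 0 = 0" "x N = 1" using m y0 xl[of 0] xr[of N] by (auto simp: N)
  have "real m * H \<le> real (dl_M \<epsilon> H) * H" using m as by (intro mult_right_mono) auto
  then show "real N * H \<le> 4 + 4 * ln (1 / \<epsilon>)" using M(4) by (simp add: N)
  have ynn: "0 \<le> y i" for i using nn by (simp add: y_def)
  have yle: "y i \<le> 1 / 2" for i using M(2)[of i] m by (auto simp: y_def)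
  have yst: "y i < y (Suc i) \<and> y (Suc i) - y i \<le> 3 * H * (y i + \<epsilon>)" if "i < m" for i
  proof -
    let ?b = "dl_base \<epsilon> H"
    have yi: "y i = ?b i" using that by (simp add: y_def)
    have p: "0 \<le> H * (?b i + \<epsilon>)" "0 \<le> H * (H * (?b i + \<epsilon>))" using nn[of i] as by auto
    show ?thesis
    proof (cases "Suc i < m")
      case True
      then have "y (Suc i) = ?b (Suc i)" by (simp add: y_def)
      then show ?thesis using st[of i] p yi by (simp add: algebra_simps)
    next
      case False
      then have ys: "y (Suc i) = 1 / 2" and im: "Suc i = m" using that by (auto simp: y_def)
      have lt: "y i < 1 / 2" using M(2)[of i] that m yi by simp
      have "dl_M \<epsilon> H = Suc i \<or> dl_M \<epsilon> H = Suc (Suc i)"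
        using im M(3) by (auto simp: m_def dl_half_def split: if_splits)
      then have "1 / 2 - ?b i \<le> 3 * H * (?b i + \<epsilon>)"
      proof
        assume "dl_M \<epsilon> H = Suc i"
        then show ?thesis using M(1) st(2)[of i] p by (simp add: algebra_simps)
      next
        \<comment> \<open>Here a node has been dropped. The first step is at most
          \<open>H * (?b i + \<epsilon>)\<close> and the second at most twice that because
          \<open>H < 1\<close>, which is where the factor 3 comes from.\<close>
        assume "dl_M \<epsilon> H = Suc (Suc i)"
        then have h: "1 / 2 \<le> ?b (Suc i) + H * (?b (Suc i) + \<epsilon>)" using M(1) st(2)[of "Suc i"] by simp
        have "H * ?b (Suc i) \<le> H * (?b i + H * (?b i + \<epsilon>))"
          using st(2)[of i] as by (intro mult_left_mono) auto
        moreover have "H * (H * (?b i + \<epsilon>)) \<le> 1 * (H * (?b i + \<epsilon>))"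
          using p as by (intro mult_right_mono) auto
        ultimately show ?thesis using h st(2)[of i] by (simp add: algebra_simps)
      qed
      then show ?thesis using ys yi lt by simp
    qed
  qed
  fix i assume i: "i \<in> {1..N}"
  show "x (i - 1) < x i \<and> 0 \<le> x (i - 1) \<and> x i \<le> 1 \<and>
      (\<exists>d\<ge>0. d \<le> x (i - 1) \<and> d \<le> 1 - x i \<and> x i - x (i - 1) \<le> 3 * H * (d + \<epsilon>))"
  proof (cases "i \<le> m")
    case True
    then have e: "x i = y i" "x (i - 1) = y (i - 1)" "y i \<le> 1 / 2"
      and s: "y (i - 1) < y i" "y i - y (i - 1) \<le> 3 * H * (y (i - 1) + \<epsilon>)"
      using xl[of i] xl[of "i - 1"] yst[of "i - 1"] i yle[of i] by auto
    show ?thesis unfolding e using s ynn[of "i - 1"] e(3) by (auto intro!: exI[of _ "y (i - 1)"])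
  next
    case False
    define j where "j = 2 * m - i"
    have j: "2 * m - (i - 1) = Suc j" "j < m" using i False N by (auto simp: j_def)
    have e: "x i = 1 - y j" "x (i - 1) = 1 - y (Suc j)"
      using xr[of i] xr[of "i - 1"] False i N j by (auto simp: j_def)
    have "1 - y j - (1 - y (Suc j)) = y (Suc j) - y j" by simp
    then show ?thesis unfolding e using yst[OF j(2)] ynn[of j] yle[of "Suc j"]
      by (auto intro!: exI[of _ "y j"])
  qed
qed

section \<open>The bilinear form\<close>

lemma jump_diff: "jump N x (\<lambda>i t. w i t - z i t) i = jump N x w i - jump N x z i"
  by (simp add: jump_def)

lemma avg_diff: "avg N x (\<lambda>i t. w i t - z i t) i = avg N x w i - avg N x z i"
  by (simp add: avg_def field_simps)

locale broken_mesh =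
  fixes x :: "nat \<Rightarrow> real" and N :: nat and c :: "real \<Rightarrow> real"
  assumes N2: "2 \<le> N" and mesh: "i \<in> {1..N} \<Longrightarrow> x (i - 1) < x i"
    and cont_c: "i \<in> {1..N} \<Longrightarrow> continuous_on {x (i - 1)..x i} c"
begin

text \<open>Continuity on the closed elements makes all integrands of the form integrable, as
  additivity and monotonicity of the integral demand.\<close>

definition pw_cont :: "(nat \<Rightarrow> real \<Rightarrow> real) \<Rightarrow> bool" where
  "pw_cont w \<longleftrightarrow> (\<forall>i\<in>{1..N}. continuous_on {x (i - 1)..x i} (w i))"

lemma pw_cont_diff: "pw_cont w \<Longrightarrow> pw_cont z \<Longrightarrow> pw_cont (\<lambda>i t. w i t - z i t)"
  by (auto simp: pw_cont_def intro!: continuous_on_diff)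

lemma pw_cont_poly: "pw_cont (\<lambda>i. poly (P i))"
  unfolding pw_cont_def by (intro ballI continuous_intros)

lemma nipg_form_diff_left:
  assumes cont: "pw_cont w" "pw_cont w'" "pw_cont z" "pw_cont z'" "pw_cont v" "pw_cont v'"
  shows "nipg_form \<epsilon> c \<sigma> N x (\<lambda>i t. w i t - z i t) (\<lambda>i t. w' i t - z' i t) v v' =
    nipg_form \<epsilon> c \<sigma> N x w w' v v' - nipg_form \<epsilon> c \<sigma> N x z z' v v'"
proof -
  have "integral {x (i - 1)..x i} (\<lambda>t. \<epsilon>\<^sup>2 * (w' i t - z' i t) * v' i t + c t * (w i t - z i t) * v i t) =
      integral {x (i - 1)..x i} (\<lambda>t. \<epsilon>\<^sup>2 * w' i t * v' i t + c t * w i t * v i t) -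
      integral {x (i - 1)..x i} (\<lambda>t. \<epsilon>\<^sup>2 * z' i t * v' i t + c t * z i t * v i t)" if i: "i \<in> {1..N}" for i
  proof -
    note [continuous_intros] = cont[unfolded pw_cont_def, rule_format, OF i] cont_c[OF i]
    show ?thesis
      by (subst integral_diff[symmetric])
        (intro integrable_continuous_real continuous_intros, intro integrable_continuous_real continuous_intros,
         simp add: algebra_simps)
  qed
  then have "(\<Sum>i=1..N. integral {x (i - 1)..x i} (\<lambda>t. \<epsilon>\<^sup>2 * (w' i t - z' i t) * v' i t + c t * (w i t - z i t) * v i t)) =
      (\<Sum>i=1..N. integral {x (i - 1)..x i} (\<lambda>t. \<epsilon>\<^sup>2 * w' i t * v' i t + c t * w i t * v i t)) -
      (\<Sum>i=1..N. integral {x (i - 1)..x i} (\<lambda>t. \<epsilon>\<^sup>2 * z' i t * v' i t + c t * z i t * v i t))"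
    unfolding sum_subtractf[symmetric] by (rule sum.cong[OF refl])
  moreover have "(\<Sum>i=0..N. \<epsilon>\<^sup>2 * (avg N x w' i - avg N x z' i) * jump N x v i
        - \<epsilon>\<^sup>2 * (jump N x w i - jump N x z i) * avg N x v' i
        + \<sigma> i * (jump N x w i - jump N x z i) * jump N x v i) =
      (\<Sum>i=0..N. \<epsilon>\<^sup>2 * avg N x w' i * jump N x v i - \<epsilon>\<^sup>2 * jump N x w i * avg N x v' i
        + \<sigma> i * jump N x w i * jump N x v i) -
      (\<Sum>i=0..N. \<epsilon>\<^sup>2 * avg N x z' i * jump N x v i - \<epsilon>\<^sup>2 * jump N x z i * avg N x v' i
        + \<sigma> i * jump N x z i * jump N x v i)"
    unfolding sum_subtractf[symmetric] by (rule sum.cong[OF refl]) (simp add: algebra_simps)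
  ultimately show ?thesis
    unfolding nipg_form_def jump_diff avg_diff by linarith
qed

text \<open>The two flux terms have opposite signs and cancel on the diagonal. This is the point of
  the nonsymmetric variant: coercivity without a lower bound on the penalty.\<close>

lemma nipg_form_self:
  "nipg_form \<epsilon> c \<sigma> N x w w' w w' =
    (\<Sum>i=1..N. integral {x (i - 1)..x i} (\<lambda>t. \<epsilon>\<^sup>2 * (w' i t)\<^sup>2 + c t * (w i t)\<^sup>2))
     + (\<Sum>i=0..N. \<sigma> i * (jump N x w i)\<^sup>2)"
  by (simp add: nipg_form_def power2_eq_square mult_ac)

text \<open>This replaces the triangle inequality of the energy norm, in squared form:
  \<open>(a - b)\<^sup>2 \<le> 2 * a\<^sup>2 + 2 * b\<^sup>2\<close> for derivatives, values and
  jumps.\<close>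

lemma nipg_form_self_diff_le:
  assumes cont: "pw_cont w" "pw_cont w'" "pw_cont z" "pw_cont z'"
    and \<sigma>: "\<And>i. 0 \<le> \<sigma> i" and c: "\<And>i t. i \<in> {1..N} \<Longrightarrow> t \<in> {x (i - 1)..x i} \<Longrightarrow> 0 \<le> c t"
  shows "nipg_form \<epsilon> c \<sigma> N x (\<lambda>i t. w i t - z i t) (\<lambda>i t. w' i t - z' i t) (\<lambda>i t. w i t - z i t) (\<lambda>i t. w' i t - z' i t)
    \<le> 2 * nipg_form \<epsilon> c \<sigma> N x w w' w w' + 2 * nipg_form \<epsilon> c \<sigma> N x z z' z z'"
proof -
  have sq: "(a - b)\<^sup>2 \<le> 2 * a\<^sup>2 + 2 * b\<^sup>2" for a b :: real
    using zero_le_power2[of "a + b"] by (simp add: power2_eq_square algebra_simps)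
  have "integral {x (i - 1)..x i} (\<lambda>t. \<epsilon>\<^sup>2 * (w' i t - z' i t)\<^sup>2 + c t * (w i t - z i t)\<^sup>2) \<le>
      2 * integral {x (i - 1)..x i} (\<lambda>t. \<epsilon>\<^sup>2 * (w' i t)\<^sup>2 + c t * (w i t)\<^sup>2) +
      2 * integral {x (i - 1)..x i} (\<lambda>t. \<epsilon>\<^sup>2 * (z' i t)\<^sup>2 + c t * (z i t)\<^sup>2)" if i: "i \<in> {1..N}" for i
  proof -
    note [continuous_intros] = cont[unfolded pw_cont_def, rule_format, OF i] cont_c[OF i]
    have "integral {x (i - 1)..x i} (\<lambda>t. \<epsilon>\<^sup>2 * (w' i t - z' i t)\<^sup>2 + c t * (w i t - z i t)\<^sup>2)
      \<le> integral {x (i - 1)..x i} (\<lambda>t. 2 * (\<epsilon>\<^sup>2 * (w' i t)\<^sup>2 + c t * (w i t)\<^sup>2)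
          + 2 * (\<epsilon>\<^sup>2 * (z' i t)\<^sup>2 + c t * (z i t)\<^sup>2))"
    proof (rule integral_le)
      fix t assume t: "t \<in> {x (i - 1)..x i}"
      show "\<epsilon>\<^sup>2 * (w' i t - z' i t)\<^sup>2 + c t * (w i t - z i t)\<^sup>2 \<le>
          2 * (\<epsilon>\<^sup>2 * (w' i t)\<^sup>2 + c t * (w i t)\<^sup>2) + 2 * (\<epsilon>\<^sup>2 * (z' i t)\<^sup>2 + c t * (z i t)\<^sup>2)"
        using mult_left_mono[OF sq[of "w' i t" "z' i t"], of "\<epsilon>\<^sup>2"] mult_left_mono[OF sq[of "w i t" "z i t"] c[OF i t]]
        by (simp add: algebra_simps)
    qed (intro integrable_continuous_real continuous_intros)+
    also have "\<dots> = 2 * integral {x (i - 1)..x i} (\<lambda>t. \<epsilon>\<^sup>2 * (w' i t)\<^sup>2 + c t * (w i t)\<^sup>2) +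
      2 * integral {x (i - 1)..x i} (\<lambda>t. \<epsilon>\<^sup>2 * (z' i t)\<^sup>2 + c t * (z i t)\<^sup>2)"
      unfolding integral_mult_right[symmetric]
      by (rule integral_add; intro integrable_continuous_real continuous_intros)
    finally show ?thesis .
  qed
  then have "(\<Sum>i=1..N. integral {x (i - 1)..x i} (\<lambda>t. \<epsilon>\<^sup>2 * (w' i t - z' i t)\<^sup>2 + c t * (w i t - z i t)\<^sup>2)) \<le>
      (\<Sum>i=1..N. 2 * integral {x (i - 1)..x i} (\<lambda>t. \<epsilon>\<^sup>2 * (w' i t)\<^sup>2 + c t * (w i t)\<^sup>2) +
      2 * integral {x (i - 1)..x i} (\<lambda>t. \<epsilon>\<^sup>2 * (z' i t)\<^sup>2 + c t * (z i t)\<^sup>2))"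
    by (intro sum_mono) auto
  moreover have "(\<Sum>i=0..N. \<sigma> i * (jump N x w i - jump N x z i)\<^sup>2) \<le>
      (\<Sum>i=0..N. 2 * (\<sigma> i * (jump N x w i)\<^sup>2) + 2 * (\<sigma> i * (jump N x z i)\<^sup>2))"
  proof (rule sum_mono)
    fix i
    show "\<sigma> i * (jump N x w i - jump N x z i)\<^sup>2 \<le>
      2 * (\<sigma> i * (jump N x w i)\<^sup>2) + 2 * (\<sigma> i * (jump N x z i)\<^sup>2)"
      using mult_left_mono[OF sq[of "jump N x w i" "jump N x z i"] \<sigma>[of i]] by (simp add: algebra_simps)
  qed
  ultimately show ?thesis
    unfolding nipg_form_self jump_diff by (simp add: sum.distrib sum_distrib_left algebra_simps)
qed

text \<open>Without jumps of \<open>w\<close>, the flux of \<open>w\<close> against the jumps of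
  \<open>v\<close> is the only face term, and the penalty in the energy of \<open>v\<close> absorbs
  it. That energy enters with factor 1 against 2 on the left, so it can be absorbed once the
  left-hand form equals the energy of \<open>v\<close>.\<close>

lemma nipg_form_le_Young:
  assumes cont: "pw_cont w" "pw_cont w'" "pw_cont v" "pw_cont v'"
    and \<sigma>: "\<And>i. 0 < \<sigma> i" and c: "\<And>i t. i \<in> {1..N} \<Longrightarrow> t \<in> {x (i - 1)..x i} \<Longrightarrow> 0 \<le> c t"
    and jump0: "\<And>i. i \<le> N \<Longrightarrow> jump N x w i = 0"
  shows "2 * nipg_form \<epsilon> c \<sigma> N x w w' v v' \<le> nipg_form \<epsilon> c \<sigma> N x v v' v v' +
      nipg_form \<epsilon> c \<sigma> N x w w' w w' + (\<Sum>i=0..N. \<epsilon>^4 * (avg N x w' i)\<^sup>2 / \<sigma> i)"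
proof -
  have arith: "2 * a \<le> p + q \<Longrightarrow> 2 * b \<le> r + s \<Longrightarrow> z = 0 \<Longrightarrow> 2 * (a + b) \<le> (p + r) + (q + z) + s"
    for a b p q r s z :: real by simp
  have ab: "2 * (a * b) \<le> a\<^sup>2 + b\<^sup>2" for a b :: real
    using zero_le_power2[of "a - b"] by (simp add: power2_eq_square algebra_simps)
  have "2 * integral {x (i - 1)..x i} (\<lambda>t. \<epsilon>\<^sup>2 * w' i t * v' i t + c t * w i t * v i t) \<le>
      integral {x (i - 1)..x i} (\<lambda>t. \<epsilon>\<^sup>2 * (v' i t)\<^sup>2 + c t * (v i t)\<^sup>2) +
      integral {x (i - 1)..x i} (\<lambda>t. \<epsilon>\<^sup>2 * (w' i t)\<^sup>2 + c t * (w i t)\<^sup>2)" if i: "i \<in> {1..N}" for i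
  proof -
    note [continuous_intros] = cont[unfolded pw_cont_def, rule_format, OF i] cont_c[OF i]
    have "integral {x (i - 1)..x i} (\<lambda>t. 2 * (\<epsilon>\<^sup>2 * w' i t * v' i t + c t * w i t * v i t)) \<le>
      integral {x (i - 1)..x i} (\<lambda>t. (\<epsilon>\<^sup>2 * (v' i t)\<^sup>2 + c t * (v i t)\<^sup>2) + (\<epsilon>\<^sup>2 * (w' i t)\<^sup>2 + c t * (w i t)\<^sup>2))"
    proof (rule integral_le)
      fix t assume t: "t \<in> {x (i - 1)..x i}"
      show "2 * (\<epsilon>\<^sup>2 * w' i t * v' i t + c t * w i t * v i t) \<le>
          (\<epsilon>\<^sup>2 * (v' i t)\<^sup>2 + c t * (v i t)\<^sup>2) + (\<epsilon>\<^sup>2 * (w' i t)\<^sup>2 + c t * (w i t)\<^sup>2)"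
        using mult_left_mono[OF ab[of "w' i t" "v' i t"], of "\<epsilon>\<^sup>2"] mult_left_mono[OF ab[of "w i t" "v i t"] c[OF i t]]
        by (simp add: algebra_simps)
    qed (intro integrable_continuous_real continuous_intros)+
    also have "\<dots> = integral {x (i - 1)..x i} (\<lambda>t. \<epsilon>\<^sup>2 * (v' i t)\<^sup>2 + c t * (v i t)\<^sup>2) +
      integral {x (i - 1)..x i} (\<lambda>t. \<epsilon>\<^sup>2 * (w' i t)\<^sup>2 + c t * (w i t)\<^sup>2)"
      by (rule integral_add; intro integrable_continuous_real continuous_intros)
    finally show ?thesis by (simp only: integral_mult_right)
  qed
  then have "2 * (\<Sum>i=1..N. integral {x (i - 1)..x i} (\<lambda>t. \<epsilon>\<^sup>2 * w' i t * v' i t + c t * w i t * v i t)) \<le>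
     (\<Sum>i=1..N. integral {x (i - 1)..x i} (\<lambda>t. \<epsilon>\<^sup>2 * (v' i t)\<^sup>2 + c t * (v i t)\<^sup>2)) +
     (\<Sum>i=1..N. integral {x (i - 1)..x i} (\<lambda>t. \<epsilon>\<^sup>2 * (w' i t)\<^sup>2 + c t * (w i t)\<^sup>2))"
    unfolding sum_distrib_left sum.distrib[symmetric] by (rule sum_mono)
  moreover have "2 * (\<Sum>i=0..N. \<epsilon>\<^sup>2 * avg N x w' i * jump N x v i - \<epsilon>\<^sup>2 * jump N x w i * avg N x v' i
        + \<sigma> i * jump N x w i * jump N x v i) \<le>
      (\<Sum>i=0..N. \<sigma> i * (jump N x v i)\<^sup>2) + (\<Sum>i=0..N. \<epsilon>^4 * (avg N x w' i)\<^sup>2 / \<sigma> i)"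
    unfolding sum_distrib_left[of 2] sum.distrib[symmetric]
  proof (rule sum_mono)
    fix i assume i: "i \<in> {0..N}"
    \<comment> \<open>Splitting the product with weight \<open>sqrt (\<sigma> i)\<close> reproduces
      exactly the penalty of \<open>v\<close>.\<close>
    let ?s = "sqrt (\<sigma> i)"
    have s: "0 < ?s" "?s\<^sup>2 = \<sigma> i" using \<sigma>[of i] by auto
    have "2 * ((\<epsilon>\<^sup>2 * avg N x w' i / ?s) * (?s * jump N x v i)) \<le>
       (\<epsilon>\<^sup>2 * avg N x w' i / ?s)\<^sup>2 + (?s * jump N x v i)\<^sup>2" by (rule ab)
    moreover have "(\<epsilon>\<^sup>2 * avg N x w' i / ?s) * (?s * jump N x v i) = \<epsilon>\<^sup>2 * avg N x w' i * jump N x v i"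
      using s(1) by (simp add: field_simps)
    moreover have "(\<epsilon>\<^sup>2 * avg N x w' i / ?s)\<^sup>2 = \<epsilon>^4 * (avg N x w' i)\<^sup>2 / \<sigma> i"
      by (simp only: power_divide power_mult_distrib s(2) power_mult[symmetric]) simp
    moreover have "(?s * jump N x v i)\<^sup>2 = \<sigma> i * (jump N x v i)\<^sup>2"
      by (simp only: power_mult_distrib s(2))
    ultimately show "2 * (\<epsilon>\<^sup>2 * avg N x w' i * jump N x v i - \<epsilon>\<^sup>2 * jump N x w i * avg N x v' i
        + \<sigma> i * jump N x w i * jump N x v i) \<le> \<sigma> i * (jump N x v i)\<^sup>2 + \<epsilon>^4 * (avg N x w' i)\<^sup>2 / \<sigma> i"
      using jump0[of i] i by simp
  qed
  moreover have "(\<Sum>i=0..N. \<sigma> i * (jump N x w i)\<^sup>2) = 0" using jump0 by simp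
  ultimately show ?thesis
    unfolding nipg_form_def[of _ _ _ _ _ w w' v v'] nipg_form_self
    by (rule arith)
qed

text \<open>Integration by parts on each element leaves boundary terms which, collected by nodes,
  cancel the flux terms: \<open>u\<close> has no jumps and the average of \<open>u1\<close> is its
  value.\<close>

lemma nipg_consistent:
  fixes u u1 f :: "real \<Rightarrow> real"
  assumes u: "\<And>i t. i \<in> {1..N} \<Longrightarrow> t \<in> {x (i - 1)..x i} \<Longrightarrow>
        (u has_real_derivative u1 t) (at t within {x (i - 1)..x i})"
    and u1: "\<And>i t. i \<in> {1..N} \<Longrightarrow> t \<in> {x (i - 1)..x i} \<Longrightarrow>
        (u1 has_real_derivative (c t * u t - f t) / \<epsilon>\<^sup>2) (at t within {x (i - 1)..x i})"
    and bd: "u (x 0) = 0" "u (x N) = 0" and \<epsilon>: "\<epsilon> \<noteq> 0"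
  shows "nipg_form \<epsilon> c \<sigma> N x (\<lambda>i. u) (\<lambda>i. u1) (\<lambda>i. poly (Q i)) (\<lambda>i. poly (pderiv (Q i)))
    = nipg_rhs f N x (\<lambda>i. poly (Q i))"
proof -
  let ?q = "\<lambda>i. poly (Q i)" and ?q' = "\<lambda>i. poly (pderiv (Q i))"
  have el: "integral {x (i - 1)..x i} (\<lambda>t. \<epsilon>\<^sup>2 * u1 t * ?q' i t + c t * u t * ?q i t) =
      integral {x (i - 1)..x i} (\<lambda>t. f t * ?q i t)
      + \<epsilon>\<^sup>2 * (u1 (x i) * ?q i (x i) - u1 (x (i - 1)) * ?q i (x (i - 1)))"
    if i: "i \<in> {1..N}" for i
  proof -
    let ?I = "{x (i - 1)..x i}"
    \<comment> \<open>By the differential equation the integrand is the derivative of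
      \<open>\<epsilon>\<^sup>2 * u1 * q\<close>, with \<open>q\<close> the test polynomial.
      Subtracting it from the integrable first part then yields the integral of
      \<open>f * q\<close>.\<close>
    have "((\<lambda>t. (\<epsilon>\<^sup>2 * u1 t * ?q' i t + c t * u t * ?q i t) - f t * ?q i t) has_integral
        \<epsilon>\<^sup>2 * u1 (x i) * ?q i (x i) - \<epsilon>\<^sup>2 * u1 (x (i - 1)) * ?q i (x (i - 1))) ?I"
    proof (rule fundamental_theorem_of_calculus)
      show "x (i - 1) \<le> x i" using mesh[OF i] by simp
      fix t assume t: "t \<in> ?I"
      have "((\<lambda>t. \<epsilon>\<^sup>2 * u1 t * ?q i t) has_real_derivative
         \<epsilon>\<^sup>2 * ((c t * u t - f t) / \<epsilon>\<^sup>2) * ?q i t + ?q' i t * (\<epsilon>\<^sup>2 * u1 t)) (at t within ?I)"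
        using u1[OF i t] by (intro DERIV_mult DERIV_cmult has_field_derivative_at_within[OF poly_DERIV])
      moreover have "\<epsilon>\<^sup>2 * ((c t * u t - f t) / \<epsilon>\<^sup>2) = c t * u t - f t"
        using \<epsilon> by simp
      then have "\<epsilon>\<^sup>2 * ((c t * u t - f t) / \<epsilon>\<^sup>2) * ?q i t + ?q' i t * (\<epsilon>\<^sup>2 * u1 t) =
          (\<epsilon>\<^sup>2 * u1 t * ?q' i t + c t * u t * ?q i t) - f t * ?q i t"
        by (simp only:) (simp add: algebra_simps)
      ultimately show "((\<lambda>t. \<epsilon>\<^sup>2 * u1 t * ?q i t) has_vector_derivative
         (\<epsilon>\<^sup>2 * u1 t * ?q' i t + c t * u t * ?q i t) - f t * ?q i t) (at t within ?I)"
        by (simp only: has_real_derivative_iff_has_vector_derivative[symmetric])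
    qed
    note 1 = this
    have "(\<lambda>t. \<epsilon>\<^sup>2 * u1 t * ?q' i t + c t * u t * ?q i t) integrable_on ?I"
      using DERIV_continuous_on[OF u[OF i]] DERIV_continuous_on[OF u1[OF i]] cont_c[OF i]
      by (intro integrable_continuous_real continuous_intros) auto
    from has_integral_diff[OF integrable_integral[OF this] 1]
    have "((\<lambda>t. f t * ?q i t) has_integral
        integral ?I (\<lambda>t. \<epsilon>\<^sup>2 * u1 t * ?q' i t + c t * u t * ?q i t) -
        (\<epsilon>\<^sup>2 * u1 (x i) * ?q i (x i) - \<epsilon>\<^sup>2 * u1 (x (i - 1)) * ?q i (x (i - 1)))) ?I" by simp
    from integral_unique[OF this] show ?thesis by (simp add: algebra_simps)
  qed
  have ju: "jump N x (\<lambda>i. u) i = 0" for i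
    using bd by (simp add: jump_def)
  have av: "avg N x (\<lambda>i. u1) i = u1 (x i)" for i
    by (simp add: avg_def)
  obtain n where n: "N = Suc n" and "1 \<le> n" using N2 by (cases N) auto
  \<comment> \<open>Summation by elements is rearranged into summation by nodes. The signs in
    \<open>jump\<close> at the nodes 0 and \<open>N\<close> are those of the two outer boundary
    terms.\<close>
  have "(\<Sum>i=1..N. u1 (x i) * ?q i (x i) - u1 (x (i - 1)) * ?q i (x (i - 1)))
      = - (\<Sum>i=0..N. u1 (x i) * jump N x ?q i)"
  proof -
    have "(\<Sum>i=0..N. u1 (x i) * jump N x ?q i) =
       u1 (x 0) * ?q 1 (x 0) + (\<Sum>i=1..n. u1 (x i) * (?q (Suc i) (x i) - ?q i (x i))) - u1 (x N) * ?q N (x N)"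
      unfolding n by (simp add: sum.atLeast_Suc_atMost jump_def)
    also have "\<dots> = (\<Sum>i=0..n. u1 (x i) * ?q (Suc i) (x i)) - (\<Sum>i=1..N. u1 (x i) * ?q i (x i))"
      unfolding n by (simp add: sum.atLeast_Suc_atMost[of 0 n] right_diff_distrib sum_subtractf)
    also have "(\<Sum>i=0..n. u1 (x i) * ?q (Suc i) (x i)) = (\<Sum>i=1..N. u1 (x (i - 1)) * ?q i (x (i - 1)))"
      unfolding n by (simp add: sum.shift_bounds_cl_Suc_ivl del: sum.cl_ivl_Suc)
    finally show ?thesis by (simp add: sum_subtractf)
  qed
  then have "\<epsilon>\<^sup>2 * (\<Sum>i=1..N. u1 (x i) * ?q i (x i) - u1 (x (i - 1)) * ?q i (x (i - 1)))
      + (\<Sum>i=0..N. \<epsilon>\<^sup>2 * u1 (x i) * jump N x ?q i) = 0"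
    by (simp add: sum_distrib_left mult.assoc)
  then show ?thesis
    unfolding nipg_form_def nipg_rhs_def ju av
    using el by (simp add: sum.distrib sum_distrib_left)
qed

end

section \<open>Error estimates\<close>

text \<open>The three bounds serve the reaction term, the fluxes and the derivative integral. Only
  the last gains a factor \<epsilon>, by including the element length. Powers of the scaled distance
  from the boundary are paid for by the decay of the layer.\<close>

lemma (in rd_data) ex_element_interpolant:
  assumes k: "1 \<le> k"
  shows "\<exists>K\<ge>0. \<forall>\<epsilon> H u u1 a b d. sol \<epsilon> u u1 \<longrightarrow> 0 < H \<longrightarrow> 0 \<le> d \<longrightarrow> d \<le> a \<longrightarrow> a < b \<longrightarrow> d \<le> 1 - b \<longrightarrow>
      b - a \<le> 3 * H * (d + \<epsilon>) \<longrightarrow>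
      (\<exists>p. degree p \<le> k \<and> poly p a = u a \<and> poly p b = u b \<and>
        (\<forall>t\<in>{a..b}. \<bar>u t - poly p t\<bar> \<le> K * H ^ (k + 1) \<and>
          \<bar>u1 t - poly (pderiv p) t\<bar> \<le> K * H ^ k / \<epsilon> \<and>
          (b - a) * (\<epsilon>\<^sup>2 * (u1 t - poly (pderiv p) t)\<^sup>2) \<le> K * (\<epsilon> * H ^ (2 * k + 1))))"
proof -
  obtain B where B0: "0 \<le> B" and B: "\<And>\<epsilon> u u1 x. sol \<epsilon> u u1 \<Longrightarrow> x \<in> {0..1} \<Longrightarrow>
      \<bar>rd_deriv C F \<epsilon> u u1 (Suc k) x\<bar> \<le> B * (1 + layer \<gamma> \<epsilon> x / \<epsilon> ^ Suc k)"
    using deriv_bound[of "Suc k"] by blast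
  \<comment> \<open>\<open>G1\<close> controls the pointwise errors. \<open>G2\<close> controls the
    squared derivative error times the length, with power \<open>2 * k + 1\<close> against the
    squared exponential.\<close>
  obtain G1 where G1: "0 \<le> G1" "\<And>s. 0 \<le> s \<Longrightarrow> (s + 1) ^ Suc k * exp (- (\<gamma> / 2 * s)) \<le> G1"
    using power_exp_bounded[of "\<gamma> / 2" "Suc k"] \<gamma>_pos by auto
  obtain G2 where G2: "0 \<le> G2" "\<And>s. 0 \<le> s \<Longrightarrow> (s + 1) ^ (2 * k + 1) * exp (- (\<gamma> * s)) \<le> G2"
    using power_exp_bounded[of "\<gamma>" "2 * k + 1"] \<gamma>_pos by auto
  define K1 where "K1 = 2 * B * 3 ^ Suc k * (2 ^ Suc k + 2 * G1)"
  define K2 where "K2 = 2 * B * 3 ^ k * (2 ^ k + 2 * G1)"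
  define K3 where "K3 = 3 * (2 * B * 3 ^ k)\<^sup>2 * (4 * 4 ^ k + 8 * G2)"
  have K: "0 \<le> K1" "0 \<le> K2" "0 \<le> K3" using B0 G1(1) G2(1) by (auto simp: K1_def K2_def K3_def)
  show ?thesis
  proof (intro exI[of _ "K1 + K2 + K3"] conjI allI impI)
    show "0 \<le> K1 + K2 + K3" using K by simp
    fix \<epsilon> H u u1 a b and d :: real
    assume s: "sol \<epsilon> u u1" and H: "0 < H" and d: "0 \<le> d" "d \<le> a" and ab: "a < b" and db: "d \<le> 1 - b"
      and h: "b - a \<le> 3 * H * (d + \<epsilon>)"
    have e: "0 < \<epsilon>" "\<epsilon> \<le> 1" using s by (auto simp: sol_def)
    \<comment> \<open>In this scaling the element length is at most
      \<open>3 * H * (\<epsilon> * r)\<close>, and \<open>E\<close> bounds each of the two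
      exponentials on the element.\<close>
    define r where "r = d / \<epsilon> + 1"
    define E where "E = exp (- (\<gamma> / 2 * (d / \<epsilon>)))"
    define M where "M = B * (1 + 2 * E / \<epsilon> ^ Suc k)"
    have r1: "1 \<le> r" using d e by (simp add: r_def)
    have er: "\<epsilon> * r = d + \<epsilon>" using e by (simp add: r_def field_simps)
    have er2: "\<epsilon> * r \<le> 2" using er e d db ab by linarith
    have er0: "0 \<le> \<epsilon> * r" using e r1 by simp
    have E0: "0 < E" by (simp add: E_def)
    have M0: "0 \<le> M" using B0 E0 e by (simp add: M_def)
    have rE1: "r ^ Suc k * E \<le> G1" using G1(2)[of "d / \<epsilon>"] d e by (simp add: r_def E_def)
    have "r ^ k * E \<le> r ^ Suc k * E" using r1 E0 by (intro mult_right_mono power_increasing) auto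
    then have rE0: "r ^ k * E \<le> G1" using rE1 by linarith
    have "E\<^sup>2 = exp (- (\<gamma> * (d / \<epsilon>)))" by (simp add: E_def power2_eq_square exp_add[symmetric])
    then have rE2: "r ^ (2 * k + 1) * E\<^sup>2 \<le> G2" using G2(2)[of "d / \<epsilon>"] d e by (simp add: r_def)
    have h': "b - a \<le> 3 * H * (\<epsilon> * r)" using h er by simp
    have pw: "(b - a) ^ n \<le> (3 * H * (\<epsilon> * r)) ^ n" for n using h' ab by (intro power_mono) auto
    have DM: "\<bar>rd_deriv C F \<epsilon> u u1 (Suc k) t\<bar> \<le> M" if t: "t \<in> {a..b}" for t
    proof -
      have t01: "t \<in> {0..1}" using t d db by auto
      have "\<gamma> / (2 * \<epsilon>) * d \<le> \<gamma> / (2 * \<epsilon>) * t" "\<gamma> / (2 * \<epsilon>) * d \<le> \<gamma> / (2 * \<epsilon>) * (1 - t)"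
        using t d db e \<gamma>_pos by (intro mult_left_mono; simp)+
      then have "layer \<gamma> \<epsilon> t \<le> 2 * E" unfolding layer_def E_def
        using add_mono[of "exp (- (\<gamma> / (2 * \<epsilon>) * t))" "exp (- (\<gamma> / 2 * (d / \<epsilon>)))"
          "exp (- (\<gamma> / (2 * \<epsilon>) * (1 - t)))" "exp (- (\<gamma> / 2 * (d / \<epsilon>)))"] by simp
      then have "layer \<gamma> \<epsilon> t / \<epsilon> ^ Suc k \<le> 2 * E / \<epsilon> ^ Suc k" using e by (intro divide_right_mono) auto
      then have "B * (1 + layer \<gamma> \<epsilon> t / \<epsilon> ^ Suc k) \<le> M" unfolding M_def using B0 by (intro mult_left_mono) auto
      then show ?thesis using B[OF s t01] by linarith
    qed
    \<comment> \<open>Up to the factor \<open>2 * B * 3 ^ k * H ^ k / \<epsilon>\<close> this is the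
      bound for the derivative error: the first summand is the smooth part, with a spare \<epsilon>,
      and the second the layer part.\<close>
    define y where "y = \<epsilon> * (\<epsilon> * r) ^ k + 2 * (r ^ k * E)"
    have y0: "0 \<le> y" unfolding y_def using e er0 r1 E0 by simp
    have yle: "y \<le> 2 ^ k * \<epsilon> + 2 * (r ^ k * E)"
      unfolding y_def using power_mono[OF er2 er0, of k] e by (simp add: mult.commute)
    have bd1: "2 * M * (b - a) ^ Suc k \<le> K1 * H ^ Suc k"
    proof -
      have "2 * M * (b - a) ^ Suc k \<le> 2 * M * (3 * H * (\<epsilon> * r)) ^ Suc k"
        using M0 by (intro mult_left_mono pw) auto
      also have "\<dots> = 2 * B * 3 ^ Suc k * H ^ Suc k * ((\<epsilon> * r) ^ Suc k + 2 * (r ^ Suc k * E))"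
        unfolding M_def power_mult_distrib using e by (simp add: field_simps)
      also have "\<dots> \<le> 2 * B * 3 ^ Suc k * H ^ Suc k * (2 ^ Suc k + 2 * G1)"
        using B0 H power_mono[OF er2 er0, of "Suc k"] rE1 by (intro mult_left_mono add_mono) auto
      finally show ?thesis by (simp add: K1_def mult_ac)
    qed
    have bd2: "2 * M * (b - a) ^ k \<le> 2 * B * 3 ^ k * H ^ k * (y / \<epsilon>)"
    proof -
      have "2 * M * (b - a) ^ k \<le> 2 * M * (3 * H * (\<epsilon> * r)) ^ k"
        using M0 by (intro mult_left_mono pw) auto
      also have "\<dots> = 2 * B * 3 ^ k * H ^ k * (y / \<epsilon>)"
        unfolding M_def y_def power_mult_distrib using e by (simp add: field_simps)
      finally show ?thesis .
    qed
    have bd2': "2 * B * 3 ^ k * H ^ k * (y / \<epsilon>) \<le> K2 * H ^ k / \<epsilon>"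
    proof -
      have "2 ^ k * \<epsilon> \<le> (2 ^ k :: real)" using e by simp
      then have "y \<le> 2 ^ k + 2 * G1" using yle rE0 by linarith
      then have "2 * B * 3 ^ k * H ^ k * (y / \<epsilon>) \<le> 2 * B * 3 ^ k * H ^ k * ((2 ^ k + 2 * G1) / \<epsilon>)"
        using B0 H e by (intro mult_left_mono divide_right_mono) auto
      then show ?thesis by (simp add: K2_def mult_ac)
    qed
    \<comment> \<open>The extra \<open>r\<close> comes from the element length. In the smooth part
      the spare \<epsilon> absorbs it through \<open>\<epsilon> * r \<le> 2\<close>, in the layer
      part \<open>E\<^sup>2\<close> does.\<close>
    have ry: "r * y\<^sup>2 \<le> 4 * 4 ^ k + 8 * G2"
    proof -
      have sq: "(p + q)\<^sup>2 \<le> 2 * p\<^sup>2 + 2 * q\<^sup>2" for p q :: real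
        using zero_le_power2[of "p - q"] by (simp add: power2_eq_square algebra_simps)
      have "y\<^sup>2 \<le> (2 ^ k * \<epsilon> + 2 * (r ^ k * E))\<^sup>2" using yle y0 by (rule power_mono)
      also have "\<dots> \<le> 2 * (2 ^ k * \<epsilon>)\<^sup>2 + 2 * (2 * (r ^ k * E))\<^sup>2" by (rule sq)
      finally have "r * y\<^sup>2 \<le> r * (2 * (2 ^ k * \<epsilon>)\<^sup>2 + 2 * (2 * (r ^ k * E))\<^sup>2)"
        using r1 by (intro mult_left_mono) auto
      also have "\<dots> = 2 * 4 ^ k * (\<epsilon> * (\<epsilon> * r)) + 8 * (r ^ (2 * k + 1) * E\<^sup>2)"
      proof -
        have "(2 ^ k)\<^sup>2 = (4 ^ k :: real)" by (simp add: power2_eq_square flip: power_mult_distrib)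
        moreover have "(r ^ k)\<^sup>2 * r = r ^ (2 * k + 1)" by (simp add: power_mult[symmetric] mult.commute)
        ultimately show ?thesis unfolding power_mult_distrib by (simp add: power2_eq_square algebra_simps)
      qed
      also have "\<dots> \<le> 2 * 4 ^ k * (1 * 2) + 8 * G2"
        using e er2 er0 rE2 by (intro add_mono mult_left_mono mult_mono) auto
      finally show ?thesis by simp
    qed
    from s have s01: "\<And>x n. x \<in> {a..b} \<Longrightarrow> (rd_deriv C F \<epsilon> u u1 n has_real_derivative
        rd_deriv C F \<epsilon> u u1 (Suc n) x) (at x within {a..b})"
      using d db by (intro DERIV_subset[OF rd_deriv_has_derivative]) auto
    obtain p where p: "degree p \<le> k" "poly p a = u a" "poly p b = u b"
      and pt: "\<And>t. t \<in> {a..b} \<Longrightarrow> \<bar>u t - poly p t\<bar> \<le> 2 * M * (b - a) ^ Suc k"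
        "\<And>t. t \<in> {a..b} \<Longrightarrow> \<bar>u1 t - poly (pderiv p) t\<bar> \<le> 2 * M * (b - a) ^ k"
      using ex_endpoint_interpolant[OF ab k s01 DM] by auto
    show "\<exists>p. degree p \<le> k \<and> poly p a = u a \<and> poly p b = u b \<and>
        (\<forall>t\<in>{a..b}. \<bar>u t - poly p t\<bar> \<le> (K1 + K2 + K3) * H ^ (k + 1) \<and>
          \<bar>u1 t - poly (pderiv p) t\<bar> \<le> (K1 + K2 + K3) * H ^ k / \<epsilon> \<and>
          (b - a) * (\<epsilon>\<^sup>2 * (u1 t - poly (pderiv p) t)\<^sup>2) \<le> (K1 + K2 + K3) * (\<epsilon> * H ^ (2 * k + 1)))"
    proof (intro exI[of _ p] conjI ballI p)
      fix t assume t: "t \<in> {a..b}"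
      have "K1 * H ^ Suc k \<le> (K1 + K2 + K3) * H ^ (k + 1)"
        using K H by (auto intro!: mult_right_mono)
      then show "\<bar>u t - poly p t\<bar> \<le> (K1 + K2 + K3) * H ^ (k + 1)" using pt(1)[OF t] bd1 by linarith
      have "K2 * H ^ k / \<epsilon> \<le> (K1 + K2 + K3) * H ^ k / \<epsilon>"
        using K H e by (intro divide_right_mono mult_right_mono) auto
      then show "\<bar>u1 t - poly (pderiv p) t\<bar> \<le> (K1 + K2 + K3) * H ^ k / \<epsilon>"
        using pt(2)[OF t] bd2 bd2' by linarith
      have "\<bar>u1 t - poly (pderiv p) t\<bar> \<le> 2 * B * 3 ^ k * H ^ k * (y / \<epsilon>)" using pt(2)[OF t] bd2 by linarith
      then have "\<bar>u1 t - poly (pderiv p) t\<bar>\<^sup>2 \<le> (2 * B * 3 ^ k * H ^ k * (y / \<epsilon>))\<^sup>2"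
        by (rule power_mono) simp
      then have "\<epsilon>\<^sup>2 * (u1 t - poly (pderiv p) t)\<^sup>2 \<le> \<epsilon>\<^sup>2 * (2 * B * 3 ^ k * H ^ k * (y / \<epsilon>))\<^sup>2"
        unfolding power2_abs by (rule mult_left_mono) simp
      also have "\<dots> = (2 * B * 3 ^ k)\<^sup>2 * H ^ (2 * k) * y\<^sup>2"
        using e by (simp add: power_mult_distrib power_divide power_mult[symmetric] mult.commute[of 2])
      finally have "(b - a) * (\<epsilon>\<^sup>2 * (u1 t - poly (pderiv p) t)\<^sup>2) \<le>
          (3 * H * (\<epsilon> * r)) * ((2 * B * 3 ^ k)\<^sup>2 * H ^ (2 * k) * y\<^sup>2)"
        by (rule mult_mono[OF h']) (use h' ab in auto)
      also have "\<dots> = 3 * (2 * B * 3 ^ k)\<^sup>2 * (\<epsilon> * H ^ (2 * k + 1)) * (r * y\<^sup>2)" by (simp add: mult_ac)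
      also have "\<dots> \<le> 3 * (2 * B * 3 ^ k)\<^sup>2 * (\<epsilon> * H ^ (2 * k + 1)) * (4 * 4 ^ k + 8 * G2)"
        using ry e H by (intro mult_left_mono) auto
      also have "\<dots> = K3 * (\<epsilon> * H ^ (2 * k + 1))" by (simp add: K3_def mult_ac)
      also have "\<dots> \<le> (K1 + K2 + K3) * (\<epsilon> * H ^ (2 * k + 1))"
        using K H e by (intro mult_right_mono) auto
      finally show "(b - a) * (\<epsilon>\<^sup>2 * (u1 t - poly (pderiv p) t)\<^sup>2) \<le> (K1 + K2 + K3) * (\<epsilon> * H ^ (2 * k + 1))" .
    qed
  qed
qed

section \<open>Reduction to the interpolation error and its summation\<close>

context broken_mesh begin

text \<open>Galerkin orthogonality turns the energy of \<open>\<xi>\<close> into the form at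
  \<open>\<eta>\<close> and \<open>\<xi>\<close>, so Young's inequality bounds it by the energy of
  \<open>\<eta>\<close> plus the flux sum. Splitting the error as \<open>\<eta> - \<xi>\<close>
  doubles both energies, which explains the factors 4 and 2.\<close>

lemma nipg_error_le_interpolation_error:
  assumes u: "\<And>i t. i \<in> {1..N} \<Longrightarrow> t \<in> {x (i - 1)..x i} \<Longrightarrow>
        (u has_real_derivative u1 t) (at t within {x (i - 1)..x i})"
    and u1: "\<And>i t. i \<in> {1..N} \<Longrightarrow> t \<in> {x (i - 1)..x i} \<Longrightarrow>
        (u1 has_real_derivative (c t * u t - f t) / \<epsilon>\<^sup>2) (at t within {x (i - 1)..x i})"
    and bd: "u (x 0) = 0" "u (x N) = 0" and \<epsilon>: "\<epsilon> \<noteq> 0"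
    and \<sigma>: "\<And>i. 0 < \<sigma> i" and c: "\<And>i t. i \<in> {1..N} \<Longrightarrow> t \<in> {x (i - 1)..x i} \<Longrightarrow> 0 \<le> c t"
    and degP: "\<And>i. i \<in> {1..N} \<Longrightarrow> degree (P i) \<le> k" and degI: "\<And>i. i \<in> {1..N} \<Longrightarrow> degree (I i) \<le> k"
    and galerkin: "\<And>Q. (\<forall>i\<in>{1..N}. degree (Q i) \<le> k) \<Longrightarrow>
       nipg_form \<epsilon> c \<sigma> N x (\<lambda>i. poly (P i)) (\<lambda>i. poly (pderiv (P i)))
           (\<lambda>i. poly (Q i)) (\<lambda>i. poly (pderiv (Q i))) = nipg_rhs f N x (\<lambda>i. poly (Q i))"
    and interp: "\<And>i. i \<in> {1..N} \<Longrightarrow> poly (I i) (x (i - 1)) = u (x (i - 1)) \<and> poly (I i) (x i) = u (x i)"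
  defines "\<eta> \<equiv> \<lambda>i t. u t - poly (I i) t" and "\<eta>' \<equiv> \<lambda>i t. u1 t - poly (pderiv (I i)) t"
  defines "e \<equiv> \<lambda>i t. u t - poly (P i) t" and "e' \<equiv> \<lambda>i t. u1 t - poly (pderiv (P i)) t"
  shows "nipg_form \<epsilon> c \<sigma> N x e e' e e' \<le>
    4 * (\<Sum>i=1..N. integral {x (i - 1)..x i} (\<lambda>t. \<epsilon>\<^sup>2 * (\<eta>' i t)\<^sup>2 + c t * (\<eta> i t)\<^sup>2))
    + 2 * (\<Sum>i=0..N. \<epsilon>^4 * (avg N x \<eta>' i)\<^sup>2 / \<sigma> i)"
proof -
  let ?A = "\<lambda>w w' v v'. nipg_form \<epsilon> c \<sigma> N x w w' v v'"
  define \<xi> where "\<xi> = (\<lambda>i. P i - I i)"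
  let ?p = "\<lambda>P i. poly (P i)" and ?p' = "\<lambda>P i. poly (pderiv (P i))"
  have pu: "pw_cont (\<lambda>i. u)" "pw_cont (\<lambda>i. u1)"
    using DERIV_continuous_on[OF u] DERIV_continuous_on[OF u1] by (auto simp: pw_cont_def)
  note pc = pu pw_cont_poly pw_cont_diff
  have p\<xi>: "?p \<xi> = (\<lambda>i t. poly (P i) t - poly (I i) t)" "?p' \<xi> = (\<lambda>i t. poly (pderiv (P i)) t - poly (pderiv (I i)) t)"
    by (auto simp: \<xi>_def fun_eq_iff pderiv_diff)
  have deg\<xi>: "\<forall>i\<in>{1..N}. degree (\<xi> i) \<le> k" using degP degI by (auto simp: \<xi>_def intro: degree_diff_le)
  have "?A (?p \<xi>) (?p' \<xi>) v v' = ?A (?p P) (?p' P) v v' - ?A (?p I) (?p' I) v v'"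
    if "pw_cont v" "pw_cont v'" for v v'
    unfolding p\<xi> by (intro nipg_form_diff_left pc that)
  then have "?A (?p \<xi>) (?p' \<xi>) (?p \<xi>) (?p' \<xi>) = ?A (?p P) (?p' P) (?p \<xi>) (?p' \<xi>) - ?A (?p I) (?p' I) (?p \<xi>) (?p' \<xi>)"
    by (simp only: pw_cont_poly)
  also have "?A (?p P) (?p' P) (?p \<xi>) (?p' \<xi>) = ?A (\<lambda>i. u) (\<lambda>i. u1) (?p \<xi>) (?p' \<xi>)"
    unfolding galerkin[OF deg\<xi>] by (rule nipg_consistent[OF u u1 bd \<epsilon>, symmetric])
  also have "\<dots> - ?A (?p I) (?p' I) (?p \<xi>) (?p' \<xi>) = ?A \<eta> \<eta>' (?p \<xi>) (?p' \<xi>)"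
    unfolding \<eta>_def \<eta>'_def by (intro nipg_form_diff_left[symmetric] pc)
  finally have orth: "?A (?p \<xi>) (?p' \<xi>) (?p \<xi>) (?p' \<xi>) = ?A \<eta> \<eta>' (?p \<xi>) (?p' \<xi>)" .
  have jump0: "jump N x \<eta> i = 0" if "i \<le> N" for i
    using interp[of 1] interp[of N] interp[of i] interp[of "Suc i"] that N2
    by (auto simp: jump_def \<eta>_def)
  have p\<eta>: "pw_cont \<eta>" "pw_cont \<eta>'" unfolding \<eta>_def \<eta>'_def by (intro pc)+
  have "2 * ?A \<eta> \<eta>' (?p \<xi>) (?p' \<xi>) \<le> ?A (?p \<xi>) (?p' \<xi>) (?p \<xi>) (?p' \<xi>) + ?A \<eta> \<eta>' \<eta> \<eta>'
      + (\<Sum>i=0..N. \<epsilon>^4 * (avg N x \<eta>' i)\<^sup>2 / \<sigma> i)"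
    by (intro nipg_form_le_Young p\<eta> pc \<sigma> c jump0)
  moreover have "?A e e' e e' \<le> 2 * ?A \<eta> \<eta>' \<eta> \<eta>' + 2 * ?A (?p \<xi>) (?p' \<xi>) (?p \<xi>) (?p' \<xi>)"
  proof -
    have "e = (\<lambda>i t. \<eta> i t - poly (\<xi> i) t)" "e' = (\<lambda>i t. \<eta>' i t - poly (pderiv (\<xi> i)) t)"
      by (auto simp: e_def e'_def \<eta>_def \<eta>'_def \<xi>_def fun_eq_iff pderiv_diff)
    then show ?thesis
      by (simp only:) (intro nipg_form_self_diff_le p\<eta> pc c less_imp_le[OF \<sigma>])
  qed
  moreover have "?A \<eta> \<eta>' \<eta> \<eta>' = (\<Sum>i=1..N. integral {x (i - 1)..x i} (\<lambda>t. \<epsilon>\<^sup>2 * (\<eta>' i t)\<^sup>2 + c t * (\<eta> i t)\<^sup>2))"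
    unfolding nipg_form_self using jump0 by simp
  ultimately show ?thesis using orth by linarith
qed

end

text \<open>The derivative part is bounded per element, so the number of elements enters, as
  \<open>N * H\<close>. The reaction part has a uniform pointwise bound and needs only the total
  length 1. For the fluxes the pointwise bound is enough, as the weight
  \<open>\<epsilon>^4 / \<sigma>\<close> restores the missing powers.\<close>

lemma (in broken_mesh) interpolation_error_sum_le:
  fixes \<eta> \<eta>' :: "nat \<Rightarrow> real \<Rightarrow> real"
  assumes x01: "x 0 = 0" "x N = 1" and \<epsilon>: "0 < \<epsilon>" and H: "0 < H" "H < 1" and K: "0 \<le> K"
    and c: "\<And>i t. i \<in> {1..N} \<Longrightarrow> t \<in> {x (i - 1)..x i} \<Longrightarrow> 0 \<le> c t \<and> c t \<le> L"
    and cont: "pw_cont \<eta>" "pw_cont \<eta>'"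
    and b0: "\<And>i t. i \<in> {1..N} \<Longrightarrow> t \<in> {x (i - 1)..x i} \<Longrightarrow> \<bar>\<eta> i t\<bar> \<le> K * H ^ (k + 1)"
    and b1: "\<And>i t. i \<in> {1..N} \<Longrightarrow> t \<in> {x (i - 1)..x i} \<Longrightarrow> \<bar>\<eta>' i t\<bar> \<le> K * H ^ k / \<epsilon>"
    and b2: "\<And>i t. i \<in> {1..N} \<Longrightarrow> t \<in> {x (i - 1)..x i} \<Longrightarrow>
        (x i - x (i - 1)) * (\<epsilon>\<^sup>2 * (\<eta>' i t)\<^sup>2) \<le> K * (\<epsilon> * H ^ (2 * k + 1))"
  shows "(\<Sum>i=1..N. integral {x (i - 1)..x i} (\<lambda>t. \<epsilon>\<^sup>2 * (\<eta>' i t)\<^sup>2 + c t * (\<eta> i t)\<^sup>2)) \<le>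
      real N * H * (K * (\<epsilon> * H ^ (2 * k))) + L * K\<^sup>2 * (H ^ (k + 1))\<^sup>2" (is "?A \<le> _")
    and "(\<Sum>i=0..N. \<epsilon>^4 * (avg N x \<eta>' i)\<^sup>2 / nipg_sigma \<epsilon> H N i) \<le> (real N * H + 3) * (K\<^sup>2 * (\<epsilon> * H ^ (2 * k)))"
proof -
  have "0 \<le> c (x 1) \<and> c (x 1) \<le> L" using c[of 1 "x 1"] mesh[of 1] N2 by simp
  then have L: "0 \<le> L" by linarith
  have "integral {x (i - 1)..x i} (\<lambda>t. \<epsilon>\<^sup>2 * (\<eta>' i t)\<^sup>2 + c t * (\<eta> i t)\<^sup>2) \<le>
      H * (K * (\<epsilon> * H ^ (2 * k))) + L * K\<^sup>2 * (H ^ (k + 1))\<^sup>2 * (x i - x (i - 1))" if i: "i \<in> {1..N}" for i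
  proof -
    note [continuous_intros] = cont[unfolded pw_cont_def, rule_format, OF i] cont_c[OF i]
    \<comment> \<open>Dividing the element's share by its length makes a constant majorant whose
      integral is that share.\<close>
    let ?B = "H * (K * (\<epsilon> * H ^ (2 * k))) / (x i - x (i - 1)) + L * K\<^sup>2 * (H ^ (k + 1))\<^sup>2"
    have h: "0 < x i - x (i - 1)" using mesh[OF i] by simp
    have "integral {x (i - 1)..x i} (\<lambda>t. \<epsilon>\<^sup>2 * (\<eta>' i t)\<^sup>2 + c t * (\<eta> i t)\<^sup>2) \<le> integral {x (i - 1)..x i} (\<lambda>t. ?B)"
    proof (rule integral_le)
      fix t assume t: "t \<in> {x (i - 1)..x i}"
      have "\<epsilon>\<^sup>2 * (\<eta>' i t)\<^sup>2 \<le> H * (K * (\<epsilon> * H ^ (2 * k))) / (x i - x (i - 1))"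
        using b2[OF i t] h by (simp add: pos_le_divide_eq mult_ac)
      moreover have "\<bar>\<eta> i t\<bar>\<^sup>2 \<le> (K * H ^ (k + 1))\<^sup>2" by (intro power_mono b0[OF i t]) simp
      then have "c t * (\<eta> i t)\<^sup>2 \<le> L * (K * H ^ (k + 1))\<^sup>2"
        using c[OF i t] L by (intro mult_mono) auto
      ultimately show "\<epsilon>\<^sup>2 * (\<eta>' i t)\<^sup>2 + c t * (\<eta> i t)\<^sup>2 \<le> ?B"
        by (simp add: power_mult_distrib mult.assoc)
    qed (intro integrable_continuous_real continuous_intros)+
    also have "\<dots> = H * (K * (\<epsilon> * H ^ (2 * k))) + L * K\<^sup>2 * (H ^ (k + 1))\<^sup>2 * (x i - x (i - 1))"
      using h by (simp add: field_simps)
    finally show ?thesis .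
  qed
  then have "?A \<le> (\<Sum>i=1..N. H * (K * (\<epsilon> * H ^ (2 * k))) + L * K\<^sup>2 * (H ^ (k + 1))\<^sup>2 * (x i - x (i - 1)))"
    by (rule sum_mono)
  also have "\<dots> = real N * H * (K * (\<epsilon> * H ^ (2 * k))) + L * K\<^sup>2 * (H ^ (k + 1))\<^sup>2 * (\<Sum>i=1..N. x i - x (i - 1))"
    by (simp add: sum.distrib sum_distrib_left)
  also have "(\<Sum>i=1..N. x i - x (i - 1)) = 1"
    using sum_telescope''[of 0 N x] x01 by (simp add: atLeastSucAtMost_greaterThanAtMost)
  finally show "?A \<le> real N * H * (K * (\<epsilon> * H ^ (2 * k))) + L * K\<^sup>2 * (H ^ (k + 1))\<^sup>2" by simp

  have av: "\<bar>avg N x \<eta>' i\<bar> \<le> K * H ^ k / \<epsilon>" if i: "i \<le> N" for i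
  proof -
    consider "i = 0" | "i \<noteq> 0" "i = N" | "i \<noteq> 0" "i < N" using i by linarith
    then show ?thesis
    proof cases
      case 1
      then show ?thesis using b1[of 1 "x 0"] mesh[of 1] N2 by (simp add: avg_def)
    next
      case 2
      then show ?thesis using b1[of N "x N"] mesh[of N] N2 by (simp add: avg_def)
    next
      case 3
      have "\<bar>\<eta>' i (x i)\<bar> \<le> K * H ^ k / \<epsilon>" "\<bar>\<eta>' (Suc i) (x i)\<bar> \<le> K * H ^ k / \<epsilon>"
        using 3 b1[of i "x i"] b1[of "Suc i" "x i"] mesh[of i] mesh[of "Suc i"] by auto
      moreover have "\<bar>(p + q) / 2\<bar> \<le> b" if "\<bar>p\<bar> \<le> b" "\<bar>q\<bar> \<le> b" for p q b :: real
        using that by (simp add: abs_le_iff)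
      ultimately have "\<bar>(\<eta>' (Suc i) (x i) + \<eta>' i (x i)) / 2\<bar> \<le> K * H ^ k / \<epsilon>" by blast
      then show ?thesis using 3 unfolding avg_def by (metis less_irrefl)
    qed
  qed
  have summand: "\<epsilon>^4 * (avg N x \<eta>' i)\<^sup>2 / nipg_sigma \<epsilon> H N i \<le>
      (if i \<in> {0, N} then 1 else H) * (K\<^sup>2 * (\<epsilon> * H ^ (2 * k)))" if "i \<le> N" for i
  proof -
    \<comment> \<open>The penalty is \<open>\<epsilon> / ?s\<close>, so the power of \<epsilon> left
      over is 4 - 2 - 1 = 1. Inner nodes carry a factor \<open>H\<close>; only the two end points
      count fully.\<close>
    let ?s = "if i \<in> {0, N} then 1 else H"
    have s: "nipg_sigma \<epsilon> H N i = \<epsilon> / ?s" by (simp add: nipg_sigma_def)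
    have "\<bar>avg N x \<eta>' i\<bar>\<^sup>2 \<le> (K * H ^ k / \<epsilon>)\<^sup>2" by (intro power_mono av that) simp
    then have "\<epsilon>^4 * (avg N x \<eta>' i)\<^sup>2 / (\<epsilon> / ?s) \<le> \<epsilon>^4 * (K * H ^ k / \<epsilon>)\<^sup>2 / (\<epsilon> / ?s)"
      using \<epsilon> H by (intro divide_right_mono mult_left_mono) auto
    note le = this
    have "\<epsilon>^4 * (a * b / \<epsilon>)\<^sup>2 / (\<epsilon> / s) = s * (a\<^sup>2 * (\<epsilon> * b\<^sup>2))" for a b s :: real
      using \<epsilon> by (simp add: power4_eq_xxxx power2_eq_square)
    then have "\<epsilon>^4 * (K * H ^ k / \<epsilon>)\<^sup>2 / (\<epsilon> / ?s) = ?s * (K\<^sup>2 * (\<epsilon> * H ^ (2 * k)))"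
      unfolding power_even_eq by blast
    with le show ?thesis unfolding s by (simp only:)
  qed
  have "(\<Sum>i=0..N. \<epsilon>^4 * (avg N x \<eta>' i)\<^sup>2 / nipg_sigma \<epsilon> H N i) \<le>
      (\<Sum>i=0..N. (if i \<in> {0, N} then 1 else H) * (K\<^sup>2 * (\<epsilon> * H ^ (2 * k))))"
    by (intro sum_mono summand) auto
  also have "\<dots> = (\<Sum>i=0..N. if i \<in> {0, N} then 1 else H) * (K\<^sup>2 * (\<epsilon> * H ^ (2 * k)))"
    by (rule sum_distrib_right[symmetric])
  also have "\<dots> \<le> (real N * H + 3) * (K\<^sup>2 * (\<epsilon> * H ^ (2 * k)))"
  proof (rule mult_right_mono)
    have "(\<Sum>i=0..N. if i \<in> {0, N} then 1 else H) \<le> (\<Sum>i=0..N. H + (if i = 0 then 1 else 0) + (if i = N then 1 else 0))"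
      using H by (intro sum_mono) auto
    also have "\<dots> = (real N + 1) * H + 2" by (simp add: sum.distrib sum.delta algebra_simps)
    finally show "(\<Sum>i=0..N. if i \<in> {0, N} then 1 else H) \<le> real N * H + 3"
      using H by (simp add: algebra_simps)
  qed (use \<epsilon> H in simp)
  finally show "(\<Sum>i=0..N. \<epsilon>^4 * (avg N x \<eta>' i)\<^sup>2 / nipg_sigma \<epsilon> H N i) \<le> (real N * H + 3) * (K\<^sup>2 * (\<epsilon> * H ^ (2 * k)))" .
qed

section \<open>The uniform error estimate in the energy norm\<close>

theorem theorem2:
  fixes c f :: "real \<Rightarrow> real" and \<gamma> :: real and k :: nat
  assumes "smooth_on_01 c" and "smooth_on_01 f"
    and "\<gamma> > 0" and "\<forall>x\<in>{0..1}. c x \<ge> \<gamma>^2"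
    and "k \<ge> 1"
  shows "\<exists>\<epsilon>0>0. \<exists>C>0. \<forall>\<epsilon> H omit u u1 u2 P.
           0 < \<epsilon> \<and> \<epsilon> < \<epsilon>0 \<and> 0 < H \<and> H < 1
           \<and> (\<forall>x\<in>{0..1}. (u has_real_derivative u1 x) (at x within {0..1})
                        \<and> (u1 has_real_derivative u2 x) (at x within {0..1}))
           \<and> (\<forall>x\<in>{0<..<1}. - (\<epsilon>^2 * u2 x) + c x * u x = f x)
           \<and> u 0 = 0 \<and> u 1 = 0
           \<and> nipg_solution \<epsilon> H omit c f k P
           \<longrightarrow> nipg_error \<epsilon> H omit c u u1 P
                 \<le> C * H^(k+1) + C * sqrt (\<epsilon> * ln (1 / \<epsilon>)) * H^k"
proof -
  obtain Dc where Dc0: "\<And>x. x \<in> {0..1} \<Longrightarrow> Dc 0 x = c x"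
    and Dc: "\<And>n x. x \<in> {0..1} \<Longrightarrow> (Dc n has_real_derivative Dc (Suc n) x) (at x within {0..1})"
    using assms(1) unfolding smooth_on_01_def by blast
  obtain Df where Df0: "\<And>x. x \<in> {0..1} \<Longrightarrow> Df 0 x = f x"
    and Df: "\<And>n x. x \<in> {0..1} \<Longrightarrow> (Df n has_real_derivative Df (Suc n) x) (at x within {0..1})"
    using assms(2) unfolding smooth_on_01_def by blast
  interpret rd_data Dc Df \<gamma>
    using Dc0 Dc Df assms(3,4) by unfold_locales auto
  obtain L where L: "0 \<le> L" "\<And>x. x \<in> {0..1} \<Longrightarrow> \<bar>Dc 0 x\<bar> \<le> L" using bounded_C[of 0] by blast
  obtain K where K0: "0 \<le> K" and K: "\<And>\<epsilon> H u u1 a b d. sol \<epsilon> u u1 \<Longrightarrow> 0 < H \<Longrightarrow> 0 \<le> d \<Longrightarrow> d \<le> a \<Longrightarrow> a < b \<Longrightarrow> d \<le> 1 - b \<Longrightarrow>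
      b - a \<le> 3 * H * (d + \<epsilon>) \<Longrightarrow>
      (\<exists>p. degree p \<le> k \<and> poly p a = u a \<and> poly p b = u b \<and>
        (\<forall>t\<in>{a..b}. \<bar>u t - poly p t\<bar> \<le> K * H ^ (k + 1) \<and>
          \<bar>u1 t - poly (pderiv p) t\<bar> \<le> K * H ^ k / \<epsilon> \<and>
          (b - a) * (\<epsilon>\<^sup>2 * (u1 t - poly (pderiv p) t)\<^sup>2) \<le> K * (\<epsilon> * H ^ (2 * k + 1))))"
    using ex_element_interpolant[OF assms(5)] by blast
  have cL: "0 \<le> c t \<and> c t \<le> L" if "t \<in> {0..1}" for t
    using L(2)[OF that] Dc0[OF that] assms(4) that by (auto intro: order_trans[of _ "\<gamma>\<^sup>2"])
  \<comment> \<open>The numbers are 4 * 8 and 2 * 11: the factors of the error splitting times the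
    bounds \<open>8 * ln (1 / \<epsilon>)\<close> for \<open>N * H\<close> and
    \<open>11 * ln (1 / \<epsilon>)\<close> for \<open>N * H + 3\<close>.\<close>
  define A1 A2 where "A1 = 32 * K + 22 * K\<^sup>2" and "A2 = 4 * (L * K\<^sup>2)"
  have A: "0 \<le> A1" "0 \<le> A2" using K0 L(1) by (auto simp: A1_def A2_def)
  define C where "C = sqrt A1 + sqrt A2 + 1"
  have C: "0 < C" "sqrt A1 \<le> C" "sqrt A2 \<le> C"
    using real_sqrt_ge_zero[OF A(1)] real_sqrt_ge_zero[OF A(2)] unfolding C_def by linarith+
  have main: "nipg_error \<epsilon> H omit c u u1 P \<le> C * H^(k+1) + C * sqrt (\<epsilon> * ln (1 / \<epsilon>)) * H^k"
    if \<epsilon>: "0 < \<epsilon>" "\<epsilon> < 1 / 4" and H: "0 < H" "H < 1"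
      and u: "\<And>x. x \<in> {0..1} \<Longrightarrow> (u has_real_derivative u1 x) (at x within {0..1})"
      and u1: "\<And>x. x \<in> {0..1} \<Longrightarrow> (u1 has_real_derivative u2 x) (at x within {0..1})"
      and ode: "\<And>x. x \<in> {0<..<1} \<Longrightarrow> - (\<epsilon>^2 * u2 x) + c x * u x = f x"
      and bd: "u 0 = 0" "u 1 = 0" and P: "nipg_solution \<epsilon> H omit c f k P"
    for \<epsilon> H omit u u1 u2 P
  proof -
    define N x where "N = dl_N \<epsilon> H omit" and "x = dl_node \<epsilon> H omit"
    note node = dl_node_properties[OF H \<epsilon>, where omit = omit, folded N_def x_def]
    have el01: "{x (i - 1)..x i} \<subseteq> {0..1}" if "i \<in> {1..N}" for i using node(5)[OF that] by auto
    \<comment> \<open>The equation is given in the open interval only; continuity of its right-hand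
      side carries it to the end points, as \<open>sol\<close> demands.\<close>
    have u1': "(u1 has_real_derivative (Dc 0 t * u t - Df 0 t) / \<epsilon>\<^sup>2) (at t within {0..1})" if "t \<in> {0..1}" for t
    proof (rule second_derivative_closed[OF u1 _ _ that])
      show "continuous_on {0..1} (\<lambda>t. (Dc 0 t * u t - Df 0 t) / \<epsilon>\<^sup>2)"
        using \<epsilon> by (intro continuous_intros DERIV_continuous_on[OF u] DERIV_continuous_on[OF Dc] DERIV_continuous_on[OF Df]) auto
      show "u2 t = (Dc 0 t * u t - Df 0 t) / \<epsilon>\<^sup>2" if "t \<in> {0<..<1}" for t
        using ode[OF that] Dc0[of t] Df0[of t] that \<epsilon> by (simp add: field_simps)
    qed
    have s: "sol \<epsilon> u u1" unfolding sol_def using \<epsilon> bd by (intro conjI ballI u u1') auto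
    interpret broken_mesh x N c
    proof
      have "continuous_on {0..1} (Dc 0)" by (rule DERIV_continuous_on[OF Dc])
      then have "continuous_on {0..1} c" by (rule continuous_on_eq) (rule Dc0)
      then show "continuous_on {x (i - 1)..x i} c" if "i \<in> {1..N}" for i
        using el01[OF that] by (rule continuous_on_subset)
    qed (use node in auto)
    let ?G = "\<lambda>i p. degree p \<le> k \<and> poly p (x (i - 1)) = u (x (i - 1)) \<and> poly p (x i) = u (x i) \<and>
        (\<forall>t\<in>{x (i - 1)..x i}. \<bar>u t - poly p t\<bar> \<le> K * H ^ (k + 1) \<and>
          \<bar>u1 t - poly (pderiv p) t\<bar> \<le> K * H ^ k / \<epsilon> \<and>
          (x i - x (i - 1)) * (\<epsilon>\<^sup>2 * (u1 t - poly (pderiv p) t)\<^sup>2) \<le> K * (\<epsilon> * H ^ (2 * k + 1)))"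
    have "\<exists>p. ?G i p" if i: "i \<in> {1..N}" for i
    proof -
      obtain d where "0 \<le> d" "d \<le> x (i - 1)" "d \<le> 1 - x i" "x i - x (i - 1) \<le> 3 * H * (d + \<epsilon>)"
        using node(5)[OF i] by blast
      then show ?thesis using node(5)[OF i] by (intro K[OF s H(1)]) auto
    qed
    then have "\<forall>i\<in>{1..N}. \<exists>p. ?G i p" by blast
    from bchoice[OF this] obtain I where I: "\<forall>i\<in>{1..N}. ?G i (I i)" by blast
    let ?\<eta> = "\<lambda>i t. u t - poly (I i) t" and ?\<eta>' = "\<lambda>i t. u1 t - poly (pderiv (I i)) t"
    let ?e = "\<lambda>i t. u t - poly (P i) t" and ?e' = "\<lambda>i t. u1 t - poly (pderiv (P i)) t"
    have uel: "(u has_real_derivative u1 t) (at t within {x (i - 1)..x i})"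
      "(u1 has_real_derivative (c t * u t - f t) / \<epsilon>\<^sup>2) (at t within {x (i - 1)..x i})"
      if "i \<in> {1..N}" "t \<in> {x (i - 1)..x i}" for i t
    proof -
      have t: "t \<in> {0..1}" using el01[OF that(1)] that(2) by blast
      show "(u has_real_derivative u1 t) (at t within {x (i - 1)..x i})"
        using u[OF t] el01[OF that(1)] by (rule DERIV_subset)
      show "(u1 has_real_derivative (c t * u t - f t) / \<epsilon>\<^sup>2) (at t within {x (i - 1)..x i})"
        using u1'[OF t] el01[OF that(1)] unfolding Dc0[OF t] Df0[OF t] by (rule DERIV_subset)
    qed
    have cel: "0 \<le> c t \<and> c t \<le> L" if "i \<in> {1..N}" "t \<in> {x (i - 1)..x i}" for i t
      using cL el01[OF that(1)] that(2) by blast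
    have \<eta>_cont: "pw_cont ?\<eta>" "pw_cont ?\<eta>'"
      using DERIV_continuous_on[OF uel(1)] DERIV_continuous_on[OF uel(2)]
      by (auto intro!: pw_cont_diff pw_cont_poly simp: pw_cont_def[of "\<lambda>i. u"] pw_cont_def[of "\<lambda>i. u1"])
    note sums = interpolation_error_sum_le[OF node(2,3) \<epsilon>(1) H K0 cel \<eta>_cont, where k = k]
    let ?F = "nipg_form \<epsilon> c (nipg_sigma \<epsilon> H N) N x ?e ?e' ?e ?e'"
    have "?F \<le> 4 * (\<Sum>i=1..N. integral {x (i - 1)..x i} (\<lambda>t. \<epsilon>\<^sup>2 * (?\<eta>' i t)\<^sup>2 + c t * (?\<eta> i t)\<^sup>2))
        + 2 * (\<Sum>i=0..N. \<epsilon>^4 * (avg N x ?\<eta>' i)\<^sup>2 / nipg_sigma \<epsilon> H N i)"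
    proof (rule nipg_error_le_interpolation_error[OF uel])
      show "0 < nipg_sigma \<epsilon> H N i" for i using \<epsilon> H by (simp add: nipg_sigma_def)
      show "degree (P i) \<le> k" if "i \<in> {1..N}" for i
        using P that by (auto simp: nipg_solution_def Let_def N_def)
      show "nipg_form \<epsilon> c (nipg_sigma \<epsilon> H N) N x (\<lambda>i. poly (P i)) (\<lambda>i. poly (pderiv (P i)))
           (\<lambda>i. poly (Q i)) (\<lambda>i. poly (pderiv (Q i))) = nipg_rhs f N x (\<lambda>i. poly (Q i))"
        if "\<forall>i\<in>{1..N}. degree (Q i) \<le> k" for Q
        using P that unfolding nipg_solution_def Let_def N_def x_def by blast
    qed (use I cel bd node \<epsilon> in auto)
    also have "\<dots> \<le> 4 * (real N * H * (K * (\<epsilon> * H ^ (2 * k))) + L * K\<^sup>2 * (H ^ (k + 1))\<^sup>2)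
        + 2 * ((real N * H + 3) * (K\<^sup>2 * (\<epsilon> * H ^ (2 * k))))"
      using I by (intro add_mono mult_left_mono sums) auto
    also have "\<dots> \<le> A1 * (\<epsilon> * ln (1 / \<epsilon>) * H ^ (2 * k)) + A2 * (H ^ (k + 1))\<^sup>2"
    proof -
      let ?l = "ln (1 / \<epsilon>)"
      \<comment> \<open>As \<open>exp 1 \<le> 4\<close>, the logarithm is at least 1 and absorbs the
        additive constants in the element count.\<close>
      have "4 \<le> 1 / \<epsilon>" using \<epsilon> by (simp add: field_simps)
      then have "exp 1 \<le> 1 / \<epsilon>" using exp_le by linarith
      then have l: "1 \<le> ?l" using \<epsilon> by (subst ln_ge_iff) auto
      have NH: "real N * H \<le> 8 * ?l" using node(4) l by linarith
      have q: "0 \<le> \<epsilon> * H ^ (2 * k)" using \<epsilon> H by simp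
      have "real N * H * (K * (\<epsilon> * H ^ (2 * k))) \<le> 8 * ?l * (K * (\<epsilon> * H ^ (2 * k)))"
        using NH K0 q by (intro mult_right_mono) auto
      moreover have "(real N * H + 3) * (K\<^sup>2 * (\<epsilon> * H ^ (2 * k))) \<le> (11 * ?l) * (K\<^sup>2 * (\<epsilon> * H ^ (2 * k)))"
        using NH l q by (intro mult_right_mono) auto
      ultimately show ?thesis unfolding A1_def A2_def by (simp add: algebra_simps)
    qed
    finally have F: "?F \<le> A1 * (\<epsilon> * ln (1 / \<epsilon>) * H ^ (2 * k)) + A2 * (H ^ (k + 1))\<^sup>2" .
    have l0: "0 \<le> \<epsilon> * ln (1 / \<epsilon>)" using \<epsilon> by simp
    have "nipg_error \<epsilon> H omit c u u1 P = sqrt ?F"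
      by (simp add: nipg_error_def dg_norm_def Let_def N_def x_def)
    also have "\<dots> \<le> sqrt (A1 * (\<epsilon> * ln (1 / \<epsilon>) * H ^ (2 * k)) + A2 * (H ^ (k + 1))\<^sup>2)"
      using F by simp
    also have "\<dots> \<le> sqrt (A1 * (\<epsilon> * ln (1 / \<epsilon>) * H ^ (2 * k))) + sqrt (A2 * (H ^ (k + 1))\<^sup>2)"
      using A l0 H by (intro sqrt_add_le_add_sqrt mult_nonneg_nonneg[of A1] mult_nonneg_nonneg[of A2]
          mult_nonneg_nonneg[of "\<epsilon> * ln (1 / \<epsilon>)"]) auto
    also have "\<dots> = sqrt A1 * (sqrt (\<epsilon> * ln (1 / \<epsilon>)) * H ^ k) + sqrt A2 * H ^ (k + 1)"
      using H unfolding power_even_eq real_sqrt_mult real_sqrt_abs by simp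
    also have "\<dots> \<le> C * (sqrt (\<epsilon> * ln (1 / \<epsilon>)) * H ^ k) + C * H ^ (k + 1)"
      using C H real_sqrt_ge_zero[OF l0] by (intro add_mono mult_right_mono) auto
    finally show ?thesis by (simp add: algebra_simps)
  qed
  show ?thesis
    \<comment> \<open>The threshold 1/4 serves both the mesh bounds and
      \<open>ln (1 / \<epsilon>) \<ge> 1\<close>.\<close>
    by (rule exI[of _ "1 / 4"], rule conjI, simp, rule exI[of _ C], intro conjI allI impI C(1)) (rule main; blast)
qed

end
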